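(* For each $i\in\{1,2\}$, let $\mathcal{H}_i$ and $\mathcal{Z}_i$ be separable Hilbert spaces, let $\mathcal{B}_i$ be a Banach space, let $\mathfrak{b}_i:\mathcal{H}_i\times\mathcal{B}_i\to\mathcal{Z}_i$ be a continuous bilinear mapping, and let $\{x^i_k\}_{k\in\mathcal{K}}\subset\mathcal{B}_i$, where $\mathcal{K}$ is a countable index set. (1) $\{x^1_j\otimes x^2_k\}_{j,k\in\mathcal{K}}$ is a b-frame (respectively, b-Riesz basis) for $\mathcal{Z}_1\otimes\mathcal{Z}_2$ with respect to $\mathfrak{b}_1\otimes\mathfrak{b}_2$ if and only if, for each $i\in\{1,2\}$, $\{x^i_k\}_{k\in\mathcal{K}}$ is a b-frame (respectively, b-Riesz basis) for $\mathcal{Z}_i$ with respect to $\mathfrak{b}_i$. (2) If, for each $i\in\{1,2\}$, the b-frame bounds of the b-frame $\{x^i_k\}_{k\in\mathcal{K}}$ are $A_i$ and $B_i$, then the b-frame bounds of the b-frame $\{x^1_j\otimes x^2_k\}_{j,k\in\mathcal{K}}$ are $A_1A_2$ and $B_1B_2$.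
   Context: For a Banach space $\mathcal{B}$, separable Hilbert spaces $\mathcal{H},\mathcal{Z}$ and a continuous bilinear mapping $\mathfrak{b}:\mathcal{H}\times\mathcal{B}\to\mathcal{Z}$ (i.e. $\|\mathfrak{b}(h,x)\|\le M\|h\|\|x\|$ for some $M>0$), the b-frame product $\langle z/x\rangle\in\mathcal{H}$ of $z\in\mathcal{Z}$ and $x\in\mathcal{B}$ is the unique vector with $\langle\mathfrak{b}(h,x),z\rangle_{\mathcal{Z}}=\langle h,\langle z/x\rangle\rangle_{\mathcal{H}}$ for all $h\in\mathcal{H}$. A countable system $\{x_k\}\subset\mathcal{B}$ is a b-frame for $\mathcal{Z}$ with b-frame bounds $A,B>0$ (with respect to $\mathfrak{b}$) if $A\|z\|_{\mathcal{Z}}^2\le\sum_k\|\langle z/x_k\rangle\|_{\mathcal{H}}^2\le B\|z\|_{\mathcal{Z}}^2$ for all $z\in\mathcal{Z}$. It is a b-basis for $\mathcal{Z}$ if each $z\in\mathcal{Z}$ has a unique representation $z=\sum_k\mathfrak{b}(h_k,x_k)$ with $h_k\in\mathcal{H}$. It is a b-Riesz basis for $\mathcal{Z}$ if it is a b-frame and a b-basis for $\mathcal{Z}$. $\mathcal{H}_1\otimes\mathcal{H}_2$ and $\mathcal{Z}_1\otimes\mathcal{Z}_2$ are the Hilbert space tensor products, and $\mathcal{B}_1\otimes\mathcal{B}_2$ is the (completed) projective tensor product of Banach spaces. The mapping $\mathfrak{b}_1\otimes\mathfrak{b}_2:(\mathcal{H}_1\otimes\mathcal{H}_2)\times(\mathcal{B}_1\otimes\mathcal{B}_2)\to\mathcal{Z}_1\otimes\mathcal{Z}_2$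 is the unique bounded bilinear mapping satisfying $$(\mathfrak{b}_1\otimes\mathfrak{b}_2)(h^1\otimes h^2,x^1\otimes x^2)=\mathfrak{b}_1(h^1,x^1)\otimes\mathfrak{b}_2(h^2,x^2)$$ for all $h^i\in\mathcal{H}_i$, $x^i\in\mathcal{B}_i$.
   Formalization: The "only if" directions in (1) are stated for nonzero Z_1 and Z_2; if Z_1={0}, every tensor system is trivially a b-frame for Z_1⊗Z_2 whatever {x^2_k} is, so the claim fails there; the "if" directions and (2) are unrestricted. *)

theory Defs
  imports "HOL-Analysis.Analysis"
begin

section \<open>Scalars\<close>

text \<open>
  The scalar field is real or complex, and everything below is parametric in it.  The axioms force
  this: every \<open>x\<close> is a root of the real polynomial
  \<open>t\<^sup>2 - (x + scalar_cnj x) t + (norm x)\<^sup>2\<close>.  See \<open>real_or_complex_cases\<close>.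
\<close>

class real_or_complex = real_normed_field +
  fixes scalar_cnj :: "'a \<Rightarrow> 'a"
  assumes scalar_cnj_add: "scalar_cnj (x + y) = scalar_cnj x + scalar_cnj y"
    and scalar_cnj_mult: "scalar_cnj (x * y) = scalar_cnj x * scalar_cnj y"
    and scalar_cnj_scaleR_one: "scalar_cnj (r *\<^sub>R 1) = r *\<^sub>R 1"
    and mult_scalar_cnj_scaleR: "x * scalar_cnj x = (norm x)\<^sup>2 *\<^sub>R 1"

instantiation real :: real_or_complex
begin

definition scalar_cnj_real :: "real \<Rightarrow> real" where
  "scalar_cnj_real x = x"

instance
  by standard (auto simp: scalar_cnj_real_def power2_eq_square)

end

instantiation complex :: real_or_complex
begin

definition scalar_cnj_complex :: "complex \<Rightarrow> complex" where
  "scalar_cnj_complex = cnj"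

instance
  by standard (auto simp: scalar_cnj_complex_def complex_norm_square scaleR_conv_of_real simp del: of_real_power)

end

lemma scalar_cnj_of_real: "scalar_cnj (of_real r :: 'k::real_or_complex) = of_real r"
  unfolding of_real_def by (rule scalar_cnj_scaleR_one)

lemma mult_scalar_cnj: "x * scalar_cnj x = of_real ((norm x)\<^sup>2)" for x :: "'k::real_or_complex"
  unfolding of_real_def by (rule mult_scalar_cnj_scaleR)

lemma add_scalar_cnj_real:
  fixes x :: "'k::real_or_complex"
  shows "\<exists>r. x + scalar_cnj x = of_real r"
proof -
  have one: "scalar_cnj (1::'k) = 1"
    using scalar_cnj_scaleR_one[of 1, where ?'a = 'k] by simp
  have "(1 + x) * scalar_cnj (1 + x) = of_real ((norm (1 + x))\<^sup>2)"
    by (rule mult_scalar_cnj)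
  then have "1 + (x + scalar_cnj x) + x * scalar_cnj x = of_real ((norm (1 + x))\<^sup>2)"
    by (simp add: scalar_cnj_add one algebra_simps)
  then have "x + scalar_cnj x = of_real ((norm (1 + x))\<^sup>2) - 1 - of_real ((norm x)\<^sup>2)"
    by (simp only: mult_scalar_cnj) (simp add: algebra_simps)
  also have "\<dots> = of_real ((norm (1 + x))\<^sup>2 - 1 - (norm x)\<^sup>2)"
    by simp
  finally show ?thesis ..
qed

lemma scalar_cnj_fixed_real:
  fixes x :: "'k::real_or_complex"
  assumes "scalar_cnj x = x"
  shows "\<exists>r. x = of_real r"
proof -
  obtain r where "x + x = of_real r"
    using add_scalar_cnj_real[of x] assms by auto
  then have "x = of_real (r / 2)"
    by (simp add: field_simps)
  then show ?thesis ..
qed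

lemma real_or_complex_cases:
  "(\<forall>x::'k::real_or_complex. \<exists>r. x = of_real r) \<or>
   (\<exists>i::'k. i * i = -1 \<and> (\<forall>x. \<exists>a b. x = of_real a + of_real b * i))"
proof (cases "\<forall>x::'k. scalar_cnj x = x")
  case True
  then show ?thesis
    using scalar_cnj_fixed_real by blast
next
  case False
  then obtain w :: 'k where w: "scalar_cnj w \<noteq> w"
    by blast
  have minus: "scalar_cnj (- x) = - scalar_cnj x" for x :: 'k
    using scalar_cnj_mult[of "-1" x] scalar_cnj_scaleR_one[of "-1", where ?'a = 'k]
    by simp
  have diff: "scalar_cnj (x - y) = scalar_cnj x - scalar_cnj y" for x y :: 'k
    using scalar_cnj_add[of x "- y"] by (simp add: minus)
  have anti: "scalar_cnj (x - scalar_cnj x) = - (x - scalar_cnj x)" for x :: 'k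
  proof -
    obtain r where r: "x + scalar_cnj x = of_real r"
      using add_scalar_cnj_real by blast
    then have "scalar_cnj x + scalar_cnj (scalar_cnj x) = of_real r"
      by (metis scalar_cnj_add scalar_cnj_of_real)
    with r have "scalar_cnj (scalar_cnj x) = x"
      by (metis add.commute add_left_cancel)
    then show ?thesis
      by (simp add: diff)
  qed
  define u where "u = w - scalar_cnj w"
  have u: "u \<noteq> 0" "scalar_cnj u = - u"
    using w anti by (auto simp: u_def)
  define i where "i = of_real (1 / norm u) * u"
  have i_cnj: "scalar_cnj i = - i"
    by (simp only: i_def scalar_cnj_mult scalar_cnj_of_real u) simp
  have "norm i = 1"
    using u by (simp add: i_def norm_mult norm_divide)
  then have "i * scalar_cnj i = 1"
    by (simp add: mult_scalar_cnj)
  then have i: "i * i = -1"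
    by (simp add: i_cnj) (metis minus_minus)
  have "\<exists>a b. x = of_real a + of_real b * i" for x
  proof -
    obtain r where r: "x + scalar_cnj x = of_real r"
      using add_scalar_cnj_real by blast
    define y where "y = x - scalar_cnj x"
    have "scalar_cnj (y * i) = y * i"
      using anti[of x] by (simp only: scalar_cnj_mult i_cnj minus_mult_minus flip: y_def)
    then obtain s where s: "y * i = of_real s"
      using scalar_cnj_fixed_real by blast
    have "y = - (y * i) * i"
      using i by (simp add: mult.assoc)
    then have y: "y = of_real (- s) * i"
      by (simp add: s)
    have "2 * x = of_real r + y"
      by (simp add: y_def flip: r)
    then have "x = of_real (r / 2) + of_real (- s / 2) * i"
      by (simp add: y field_simps)
    then show ?thesis
      by blast
  qed
  with i show ?thesis
    by blast
qed


section \<open>Banach and Hilbert spaces over the scalar field\<close>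

locale banach_space_over = vector_space scale
  for scale :: "'k::real_or_complex \<Rightarrow> 'v::banach \<Rightarrow> 'v" +
  assumes scale_of_real: "scale (of_real r) x = r *\<^sub>R x"
    and norm_scale: "norm (scale c x) = norm c * norm x"

text \<open>The inner product is linear in the first argument; completeness is part of the class \<open>banach\<close>.\<close>

locale hilbert_space_over = banach_space_over scale
  for scale :: "'k::real_or_complex \<Rightarrow> 'v::banach \<Rightarrow> 'v" +
  fixes ip :: "'v \<Rightarrow> 'v \<Rightarrow> 'k"
  assumes ip_add_left: "ip (x + y) z = ip x z + ip y z"
    and ip_scale_left: "ip (scale c x) z = c * ip x z"
    and ip_commute: "ip y x = scalar_cnj (ip x y)"
    and ip_self: "ip x x = of_real ((norm x)\<^sup>2)"

lemma hilbert_space_over_real_inner: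
  "hilbert_space_over (*\<^sub>R) (inner :: 'a::{real_inner, banach} \<Rightarrow> 'a \<Rightarrow> real)"
  by unfold_locales
    (auto simp: inner_add_left inner_add_right scalar_cnj_real_def inner_commute power2_norm_eq_inner
      scaleR_add_right scaleR_add_left)

definition bilinear_over ::
  "('k::field \<Rightarrow> 'u::ab_group_add \<Rightarrow> 'u) \<Rightarrow> ('k \<Rightarrow> 'v::ab_group_add \<Rightarrow> 'v) \<Rightarrow>
   ('k \<Rightarrow> 'w::ab_group_add \<Rightarrow> 'w) \<Rightarrow> ('u \<Rightarrow> 'v \<Rightarrow> 'w) \<Rightarrow> bool" where
  "bilinear_over sU sV sW f \<longleftrightarrow>
     (\<forall>u. Vector_Spaces.linear sV sW (f u)) \<and> (\<forall>v. Vector_Spaces.linear sU sW (\<lambda>u. f u v))"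

definition bounded_bilinear_over ::
  "('k::field \<Rightarrow> 'u::real_normed_vector \<Rightarrow> 'u) \<Rightarrow> ('k \<Rightarrow> 'v::real_normed_vector \<Rightarrow> 'v) \<Rightarrow>
   ('k \<Rightarrow> 'w::real_normed_vector \<Rightarrow> 'w) \<Rightarrow> ('u \<Rightarrow> 'v \<Rightarrow> 'w) \<Rightarrow> bool" where
  "bounded_bilinear_over sU sV sW f \<longleftrightarrow>
     bilinear_over sU sV sW f \<and> (\<exists>M>0. \<forall>u v. norm (f u v) \<le> M * norm u * norm v)"


section \<open>b-frames\<close>

definition b_frame_product ::
  "('h \<Rightarrow> 'h \<Rightarrow> 'k) \<Rightarrow> ('z \<Rightarrow> 'z \<Rightarrow> 'k) \<Rightarrow> ('h \<Rightarrow> 'b \<Rightarrow> 'z) \<Rightarrow> 'z \<Rightarrow> 'b \<Rightarrow> 'h" where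
  "b_frame_product ipH ipZ b z x = (THE g. \<forall>h. ipZ (b h x) z = ipH h g)"

text \<open>
  \<open>infsum\<close> is \<open>0\<close> on families that are not summable, so summability is required explicitly.
\<close>

definition b_frame_with_bounds ::
  "('h::real_normed_vector \<Rightarrow> 'h \<Rightarrow> 'k) \<Rightarrow> ('z::real_normed_vector \<Rightarrow> 'z \<Rightarrow> 'k) \<Rightarrow>
   ('h \<Rightarrow> 'b \<Rightarrow> 'z) \<Rightarrow> 'i set \<Rightarrow> ('i \<Rightarrow> 'b) \<Rightarrow> real \<Rightarrow> real \<Rightarrow> bool" where
  "b_frame_with_bounds ipH ipZ b K x A B \<longleftrightarrow>
     A > 0 \<and> B > 0 \<and>
     (\<forall>z. (\<lambda>k. (norm (b_frame_product ipH ipZ b z (x k)))\<^sup>2) summable_on K \<and>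
          A * (norm z)\<^sup>2 \<le> (\<Sum>\<^sub>\<infinity>k\<in>K. (norm (b_frame_product ipH ipZ b z (x k)))\<^sup>2) \<and>
          (\<Sum>\<^sub>\<infinity>k\<in>K. (norm (b_frame_product ipH ipZ b z (x k)))\<^sup>2) \<le> B * (norm z)\<^sup>2)"

definition b_frame ::
  "('h::real_normed_vector \<Rightarrow> 'h \<Rightarrow> 'k) \<Rightarrow> ('z::real_normed_vector \<Rightarrow> 'z \<Rightarrow> 'k) \<Rightarrow>
   ('h \<Rightarrow> 'b \<Rightarrow> 'z) \<Rightarrow> 'i set \<Rightarrow> ('i \<Rightarrow> 'b) \<Rightarrow> bool" where
  "b_frame ipH ipZ b K x \<longleftrightarrow> (\<exists>A B. b_frame_with_bounds ipH ipZ b K x A B)"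

text \<open>
  The countable index set carries no order, so the series converges in the sense of \<open>has_sum\<close>
  (unconditionally).  A coefficient family indexed by \<open>K\<close> is an element of \<open>extensional K\<close>.
\<close>

definition b_basis ::
  "('h \<Rightarrow> 'b \<Rightarrow> 'z::real_normed_vector) \<Rightarrow> 'i set \<Rightarrow> ('i \<Rightarrow> 'b) \<Rightarrow> bool" where
  "b_basis b K x \<longleftrightarrow>
     (\<forall>z. \<exists>!h. h \<in> extensional K \<and> ((\<lambda>k. b (h k) (x k)) has_sum z) K)"

definition b_riesz_basis ::
  "('h::real_normed_vector \<Rightarrow> 'h \<Rightarrow> 'k) \<Rightarrow> ('z::real_normed_vector \<Rightarrow> 'z \<Rightarrow> 'k) \<Rightarrow>
   ('h \<Rightarrow> 'b \<Rightarrow> 'z) \<Rightarrow> 'i set \<Rightarrow> ('i \<Rightarrow> 'b) \<Rightarrow> bool" where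
  "b_riesz_basis ipH ipZ b K x \<longleftrightarrow> b_frame ipH ipZ b K x \<and> b_basis b K x"


section \<open>Tensor products\<close>

text \<open>
  A tensor product is a space together with its map \<open>(x, y) \<mapsto> x \<otimes> y\<close>, given up to isometric
  isomorphism.  The linear span of the elementary tensors is the algebraic tensor product; the
  whole space is its completion.
\<close>

definition elementary_span ::
  "('k::real_or_complex \<Rightarrow> 't::ab_group_add \<Rightarrow> 't) \<Rightarrow> ('u \<Rightarrow> 'v \<Rightarrow> 't) \<Rightarrow> 't set" where
  "elementary_span s tens = module.span s {tens x y | x y. True}"

text \<open>
  For the Hilbert space tensor product, the formula for the inner product already makes the
  canonical map from the algebraic tensor product injective.
\<close>

definition hilbert_tensor_product ::
  "('k::real_or_complex \<Rightarrow> 'u::banach \<Rightarrow> 'u) \<Rightarrow> ('u \<Rightarrow> 'u \<Rightarrow> 'k) \<Rightarrow>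
   ('k \<Rightarrow> 'v::banach \<Rightarrow> 'v) \<Rightarrow> ('v \<Rightarrow> 'v \<Rightarrow> 'k) \<Rightarrow>
   ('k \<Rightarrow> 't::banach \<Rightarrow> 't) \<Rightarrow> ('t \<Rightarrow> 't \<Rightarrow> 'k) \<Rightarrow> ('u \<Rightarrow> 'v \<Rightarrow> 't) \<Rightarrow> bool" where
  "hilbert_tensor_product sU ipU sV ipV s ip tens \<longleftrightarrow>
     hilbert_space_over s ip \<and>
     bilinear_over sU sV s tens \<and>
     (\<forall>u v u' v'. ip (tens u v) (tens u' v') = ipU u u' * ipV v v') \<and>
     closure (elementary_span s tens) = UNIV"

text \<open>
  For a bilinear map \<open>tens\<close>, the second condition says that the canonical linear map from the
  algebraic tensor product is injective: a nonzero algebraic tensor is a finite sum of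
  \<open>x \<otimes> y\<^sub>x\<close> with linearly independent \<open>x\<close> and some \<open>y\<^sub>x \<noteq> 0\<close>.
\<close>

definition algebraic_tensor_map ::
  "('k::real_or_complex \<Rightarrow> 'u::ab_group_add \<Rightarrow> 'u) \<Rightarrow> ('k \<Rightarrow> 'v::ab_group_add \<Rightarrow> 'v) \<Rightarrow>
   ('k \<Rightarrow> 't::ab_group_add \<Rightarrow> 't) \<Rightarrow> ('u \<Rightarrow> 'v \<Rightarrow> 't) \<Rightarrow> bool" where
  "algebraic_tensor_map sU sV s tens \<longleftrightarrow>
     bilinear_over sU sV s tens \<and>
     (\<forall>X y. finite X \<and> \<not> module.dependent sU X \<and> (\<Sum>x\<in>X. tens x (y x)) = 0 \<longrightarrow>
            (\<forall>x\<in>X. y x = 0))"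

definition projective_norm ::
  "('u::real_normed_vector \<Rightarrow> 'v::real_normed_vector \<Rightarrow> 't::ab_group_add) \<Rightarrow> 't \<Rightarrow> real" where
  "projective_norm tens t =
     Inf {\<Sum>i<n. norm (x i) * norm (y i) | (n::nat) x y. t = (\<Sum>i<n. tens (x i) (y i))}"

definition projective_tensor_product ::
  "('k::real_or_complex \<Rightarrow> 'u::banach \<Rightarrow> 'u) \<Rightarrow> ('k \<Rightarrow> 'v::banach \<Rightarrow> 'v) \<Rightarrow>
   ('k \<Rightarrow> 't::banach \<Rightarrow> 't) \<Rightarrow> ('u \<Rightarrow> 'v \<Rightarrow> 't) \<Rightarrow> bool" where
  "projective_tensor_product sU sV s tens \<longleftrightarrow>
     banach_space_over s \<and>
     algebraic_tensor_map sU sV s tens \<and>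
     (\<forall>t\<in>elementary_span s tens. norm t = projective_norm tens t) \<and>
     closure (elementary_span s tens) = UNIV"

text \<open>
  \<open>b\<close> is the mapping \<open>b1 \<otimes> b2\<close>; the elementary tensors have dense span, so these conditions
  determine it.
\<close>

definition bilinear_tensor_product ::
  "('k::real_or_complex \<Rightarrow> 'h::real_normed_vector \<Rightarrow> 'h) \<Rightarrow> ('h1 \<Rightarrow> 'h2 \<Rightarrow> 'h) \<Rightarrow>
   ('k \<Rightarrow> 'b::real_normed_vector \<Rightarrow> 'b) \<Rightarrow> ('b1 \<Rightarrow> 'b2 \<Rightarrow> 'b) \<Rightarrow>
   ('k \<Rightarrow> 'z::real_normed_vector \<Rightarrow> 'z) \<Rightarrow> ('z1 \<Rightarrow> 'z2 \<Rightarrow> 'z) \<Rightarrow>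
   ('h1 \<Rightarrow> 'b1 \<Rightarrow> 'z1) \<Rightarrow> ('h2 \<Rightarrow> 'b2 \<Rightarrow> 'z2) \<Rightarrow> ('h \<Rightarrow> 'b \<Rightarrow> 'z) \<Rightarrow> bool" where
  "bilinear_tensor_product sH tensH sB tensB sZ tensZ b1 b2 b \<longleftrightarrow>
     bounded_bilinear_over sH sB sZ b \<and>
     (\<forall>h1 h2 x1 x2. b (tensH h1 h2) (tensB x1 x2) = tensZ (b1 h1 x1) (b2 h2 x2))"

end

theory Submission
  imports Defs
begin

text \<open>
  Write \<open>T\<^sub>k h = b h (x k)\<close>; the b-frame product \<open>z \<mapsto> \<langle>z/x\<^sub>k\<rangle>\<close> is its adjoint, and on elementary tensors
  the adjoint of \<open>T1\<^sub>j \<otimes> T2\<^sub>k\<close> is the tensor product of the adjoints.  For \<open>z = \<Sum>\<^sub>i u\<^sub>i \<otimes> v\<^sub>i\<close> the number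
  \<open>\<parallel>\<langle>z/x\<^sub>j\<^sub>k\<rangle>\<parallel>\<^sup>2\<close> is therefore a sum over pairs \<open>i, i'\<close> of products of inner products; factoring the Gram
  matrix of one family turns it into a finite sum of squares in the other factor, so the frame
  inequalities can be applied one factor at a time, and they extend to the closure by continuity.
  Elementary tensors \<open>z1 \<otimes> z2\<close> give the converse.  For b-Riesz bases, surjectivity of the frame
  operator \<open>S = \<Sum>\<^sub>k T\<^sub>k T\<^sub>k\<^sup>*\<close> yields expansions in every b-frame, and uniqueness is equivalent to the
  existence, for all \<open>j\<close> and \<open>g\<close>, of some \<open>y\<close> with \<open>\<langle>y/x\<^sub>k\<rangle> = \<delta>\<^sub>j\<^sub>k g\<close>.
\<close>

section \<open>Hilbert spaces\<close>

lemma scalar_cnj_0 [simp]: "scalar_cnj (0::'k::real_or_complex) = 0"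
  using scalar_cnj_of_real[of 0, where 'k='k] by simp

context hilbert_space_over
begin

lemma ip_add_right: "ip x (y + z) = ip x y + ip x z"
  by (metis ip_add_left ip_commute scalar_cnj_add)

lemma ip_scale_right: "ip x (scale c y) = scalar_cnj c * ip x y"
  by (metis ip_scale_left ip_commute scalar_cnj_mult)

lemma scaleR_scale: "r *\<^sub>R x = scale (of_real r) x"
  by (simp add: scale_of_real)

lemma ip_zero_left [simp]: "ip 0 y = 0"
  using ip_add_left[of 0 0 y] by simp

lemma ip_zero_right [simp]: "ip y 0 = 0"
  using ip_add_right[of y 0 0] by simp

lemma ip_minus_left: "ip (- x) y = - ip x y"
  using ip_add_left[of x "- x" y] by (simp add: eq_neg_iff_add_eq_0 add.commute)

lemma ip_minus_right: "ip y (- x) = - ip y x"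
  using ip_add_right[of y x "- x"] by (simp add: eq_neg_iff_add_eq_0 add.commute)

lemma ip_diff_left: "ip (x - y) z = ip x z - ip y z"
  using ip_add_left[of x "- y" z] by (simp add: ip_minus_left)

lemma ip_diff_right: "ip z (x - y) = ip z x - ip z y"
  using ip_add_right[of z x "- y"] by (simp add: ip_minus_right)

lemma ip_scaleR_left: "ip (r *\<^sub>R x) y = of_real r * ip x y"
  by (simp add: scaleR_scale ip_scale_left)

lemma ip_scaleR_right: "ip x (r *\<^sub>R y) = of_real r * ip x y"
  by (simp add: scaleR_scale ip_scale_right scalar_cnj_of_real)

text \<open>Pythagoras: the subtracted vector is the projection of \<open>x\<close> onto the line
  through \<open>y\<close>. Nonnegativity of the left side gives Cauchy-Schwarz, and the drop in
  norm drives the minimality argument for Riesz representation.\<close>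

lemma norm_diff_projection:
  assumes "y \<noteq> 0"
  shows "(norm (x - scale (ip x y / of_real ((norm y)\<^sup>2)) y))\<^sup>2 = (norm x)\<^sup>2 - (norm (ip x y))\<^sup>2 / (norm y)\<^sup>2"
proof -
  define N :: 'k where "N = of_real ((norm y)\<^sup>2)"
  have N: "N \<noteq> 0" "scalar_cnj N = N" "ip y y = N"
    using assms by (auto simp: N_def ip_self scalar_cnj_of_real simp del: of_real_power)
  \<comment> \<open>Conjugation is multiplicative and fixes the real number \<open>N\<close>, so it
    passes through division by \<open>N\<close>.\<close>
  have cdiv: "scalar_cnj (c / N) = scalar_cnj c / N" for c
    using N scalar_cnj_mult[of "c / N" N] by (simp add: eq_divide_eq)
  have "of_real ((norm (x - scale (ip x y / N) y))\<^sup>2)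
      = ip x x - ip x y * scalar_cnj (ip x y) / N"
    unfolding ip_self[symmetric] using N
    by (simp add: ip_diff_left ip_diff_right ip_scale_left ip_scale_right cdiv ip_commute[of y x] field_simps)
  also have "\<dots> = of_real ((norm x)\<^sup>2 - (norm (ip x y))\<^sup>2 / (norm y)\<^sup>2)"
    by (simp add: mult_scalar_cnj ip_self N_def)
  finally show ?thesis
    unfolding N_def of_real_eq_iff .
qed

lemma Cauchy_Schwarz: "norm (ip x y) \<le> norm x * norm y"
proof (cases "y = 0")
  case False
  have "0 \<le> (norm x)\<^sup>2 - (norm (ip x y))\<^sup>2 / (norm y)\<^sup>2"
    unfolding norm_diff_projection[OF False, symmetric] by simp
  then have "(norm (ip x y))\<^sup>2 \<le> (norm x * norm y)\<^sup>2"
    using False by (simp add: field_simps)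
  then show ?thesis
    by (rule power2_le_imp_le) simp
qed simp

text \<open>\<open>bounded_bilinear\<close> concerns real scalars, on which the conjugation in the
  second argument is invisible; continuity and the rules for finite sums then apply to both
  arguments.\<close>

lemma bounded_bilinear_ip: "bounded_bilinear ip"
proof
  show "\<exists>K. \<forall>a b. norm (ip a b) \<le> norm a * norm b * K"
    by (rule exI[of _ 1]) (simp add: Cauchy_Schwarz)
qed (simp_all add: ip_add_left ip_add_right ip_scaleR_left ip_scaleR_right scaleR_conv_of_real)

lemmas bounded_linear_ip_left = bounded_bilinear.bounded_linear_left[OF bounded_bilinear_ip]
lemmas ip_sum_left = bounded_bilinear.sum_left[OF bounded_bilinear_ip]
lemmas ip_sum_right = bounded_bilinear.sum_right[OF bounded_bilinear_ip]

lemma ip_ext: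
  assumes "\<And>h. ip h x = ip h y"
  shows "x = y"
proof -
  have "ip (x - y) (x - y) = 0"
    using assms[of "x - y"] by (simp add: ip_diff_right)
  then show ?thesis
    by (simp add: ip_self)
qed

lemma norm_eq_ip: "norm (ip x x) = (norm x)\<^sup>2"
  by (simp add: ip_self norm_power)

section \<open>Points of minimal norm and Riesz representation\<close>

lemma parallelogram:
  fixes x y :: 'v
  shows "(norm (x + y))\<^sup>2 + (norm (x - y))\<^sup>2 = 2 * (norm x)\<^sup>2 + 2 * (norm y)\<^sup>2"
proof -
  have "(of_real ((norm (x + y))\<^sup>2 + (norm (x - y))\<^sup>2) :: 'k) = of_real (2 * (norm x)\<^sup>2 + 2 * (norm y)\<^sup>2)"
    unfolding of_real_add of_real_mult ip_self[symmetric]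
    by (simp add: ip_add_left ip_add_right ip_diff_left ip_diff_right)
  then show ?thesis
    by (simp only: of_real_eq_iff)
qed

text \<open>The parallelogram law makes a minimizing sequence Cauchy. Convexity enters through
  midpoints, hence the form of \<open>mid\<close>.\<close>

lemma closed_convex_has_minimal_norm:
  fixes C :: "'v set"
  assumes "closed C" "C \<noteq> {}" and mid: "\<And>x y. x \<in> C \<Longrightarrow> y \<in> C \<Longrightarrow> (1/2) *\<^sub>R (x + y) \<in> C"
  shows "\<exists>p\<in>C. \<forall>x\<in>C. norm p \<le> norm x"
proof -
  define d where "d = Inf (norm ` C)"
  have bdd: "bdd_below (norm ` C)"
    by (rule bdd_belowI[of _ 0]) auto
  have d: "d \<le> norm x" if "x \<in> C" for x
    unfolding d_def using that bdd by (intro cInf_lower) auto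
  have "d \<ge> 0"
    unfolding d_def using assms(2) by (intro cInf_greatest) auto
  have "\<exists>x\<in>C. norm x < d + 1 / real (Suc n)" for n
    using cInf_lessD[of "norm ` C" "d + 1 / real (Suc n)"] assms(2) by (auto simp: d_def)
  then obtain X where X: "\<And>n. X n \<in> C" "\<And>n. norm (X n) < d + 1 / real (Suc n)"
    by metis
  have norm_lim: "(\<lambda>n. norm (X n)) \<longlonglongrightarrow> d"
  proof (rule real_tendsto_sandwich[where f="\<lambda>_. d" and h="\<lambda>n. d + 1 / real (Suc n)"])
    show "(\<lambda>n. d + 1 / real (Suc n)) \<longlonglongrightarrow> d"
      using tendsto_add[OF tendsto_const LIMSEQ_inverse_real_of_nat] by (simp add: inverse_eq_divide)
  qed (use X d in \<open>auto intro!: less_imp_le always_eventually\<close>)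
  \<comment> \<open>The midpoint lies in \<open>C\<close>, so its norm is at least \<open>d\<close>;
    the parallelogram law then bounds the distance by the excess of the two norms over
    \<open>d\<close>.\<close>
  have diff: "(norm (X m - X n))\<^sup>2 \<le> 2 * ((norm (X m))\<^sup>2 - d\<^sup>2) + 2 * ((norm (X n))\<^sup>2 - d\<^sup>2)" for m n
  proof -
    have "2 * d \<le> norm (X m + X n)"
      using d[OF mid[OF X(1)[of m] X(1)[of n]]] by simp
    then have "(2 * d)\<^sup>2 \<le> (norm (X m + X n))\<^sup>2"
      using \<open>d \<ge> 0\<close> by (intro power_mono) auto
    then show ?thesis
      using parallelogram[of "X m" "X n"] by (simp add: power_mult_distrib)
  qed
  have "Cauchy X"
  proof (rule metric_CauchyI)
    fix e :: real assume "e > 0"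
    have "(\<lambda>n. (norm (X n))\<^sup>2 - d\<^sup>2) \<longlonglongrightarrow> d\<^sup>2 - d\<^sup>2"
      by (intro tendsto_intros norm_lim)
    \<comment> \<open>Each of the two excesses in \<open>diff\<close> carries a factor 2, hence the
      quarter.\<close>
    moreover have "e\<^sup>2 / 4 > 0"
      using \<open>e > 0\<close> by simp
    ultimately obtain M where M: "\<And>n. n \<ge> M \<Longrightarrow> (norm (X n))\<^sup>2 - d\<^sup>2 < e\<^sup>2 / 4"
      using order_tendstoD(2)[of "\<lambda>n. (norm (X n))\<^sup>2 - d\<^sup>2" 0 sequentially "e\<^sup>2 / 4"]
      unfolding eventually_sequentially by auto
    show "\<exists>M. \<forall>m\<ge>M. \<forall>n\<ge>M. dist (X m) (X n) < e"
    proof (intro exI allI impI)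
      fix m n assume "m \<ge> M" "n \<ge> M"
      then have "(norm (X m - X n))\<^sup>2 < e\<^sup>2"
        using diff[of m n] M[of m] M[of n] by simp
      then show "dist (X m) (X n) < e"
        using \<open>e > 0\<close> unfolding dist_norm by (intro power2_less_imp_less[of _ e]) auto
    qed
  qed
  then obtain p where p: "X \<longlonglongrightarrow> p"
    using Cauchy_convergent unfolding convergent_def by metis
  then have "p \<in> C"
    using closed_sequentially[OF assms(1) X(1)] by simp
  moreover have "norm p = d"
    using LIMSEQ_unique[OF tendsto_norm[OF p] norm_lim] .
  ultimately show ?thesis
    using d by auto
qed

text \<open>A point \<open>p\<close> of minimal norm on the hyperplane \<open>f h = 1\<close> is
  orthogonal to the kernel of \<open>f\<close>; rescaling \<open>p\<close> by the inverse of its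
  squared norm gives the representing vector.\<close>

theorem Riesz_representation:
  assumes add: "\<And>x y. f (x + y) = f x + f y"
    and scale: "\<And>c x. f (scale c x) = c * f x"
    and bounded: "\<And>x. norm (f x) \<le> M * norm x"
  shows "\<exists>g. \<forall>h. f h = ip h g"
proof (cases "\<forall>h. f h = 0")
  case True
  then show ?thesis
    by (intro exI[of _ 0]) simp
next
  case False
  then obtain h0 where h0: "f h0 \<noteq> 0"
    by blast
  have f_scaleR: "f (r *\<^sub>R x) = r *\<^sub>R f x" for r x
    by (simp add: scaleR_scale scale scaleR_conv_of_real)
  have bl: "bounded_linear f"
    by (rule bounded_linear_intro[where K=M]) (use add f_scaleR bounded in \<open>auto simp: mult.commute\<close>)
  define C where "C = {h. f h = 1}"
  have "closed C"
    unfolding C_def using linear_continuous_on[OF bl] continuous_on_const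
    by (rule closed_Collect_eq)
  moreover have "C \<noteq> {}"
    using scale[of "inverse (f h0)" h0] h0 by (auto simp: C_def)
  moreover have "(1/2) *\<^sub>R (x + y) \<in> C" if "x \<in> C" "y \<in> C" for x y
    using that by (simp add: C_def f_scaleR add scaleR_conv_of_real)
  ultimately obtain p where p: "p \<in> C" and min: "\<And>x. x \<in> C \<Longrightarrow> norm p \<le> norm x"
    using closed_convex_has_minimal_norm[of C] by blast
  have fp: "f p = 1"
    using p by (simp add: C_def)
  have "p \<noteq> 0"
    using fp f_scaleR[of 0 p] by auto
  \<comment> \<open>Removing from \<open>p\<close> its component along a kernel vector
    \<open>u\<close> stays on the hyperplane, and it would shorten \<open>p\<close> unless
    \<open>ip p u = 0\<close>.\<close>
  have orth: "ip p u = 0" if u: "f u = 0" for u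
  proof (cases "u = 0")
    case False
    define q where "q = p - scale (ip p u / of_real ((norm u)\<^sup>2)) u"
    have "f q + f (scale (ip p u / of_real ((norm u)\<^sup>2)) u) = f p"
      unfolding add[symmetric] q_def by simp
    then have "q \<in> C"
      by (simp add: C_def scale u fp)
    then have "(norm p)\<^sup>2 \<le> (norm q)\<^sup>2"
      using min by (intro power_mono) auto
    then have "(norm (ip p u))\<^sup>2 / (norm u)\<^sup>2 \<le> 0"
      unfolding q_def norm_diff_projection[OF False] by simp
    then show ?thesis
      using False by (simp add: divide_le_0_iff)
  qed simp
  show ?thesis
  proof (intro exI allI)
    fix h
    \<comment> \<open>This splits \<open>h\<close> into a multiple of \<open>p\<close> and a kernel
      vector.\<close>
    have "f (h - scale (f h) p) = 0"
      using add[of "h - scale (f h) p" "scale (f h) p"] by (simp add: scale fp)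
    then have "ip (h - scale (f h) p) p = 0"
      using orth ip_commute[of "h - scale (f h) p" p] by simp
    then have "ip h p = f h * of_real ((norm p)\<^sup>2)"
      by (simp add: ip_diff_left ip_scale_left ip_self)
    then show "f h = ip h (scaleR (1 / (norm p)\<^sup>2) p)"
      using \<open>p \<noteq> 0\<close> by (simp add: ip_scaleR_right)
  qed
qed

end

section \<open>The frame operator\<close>

lemma summable_on_CauchyI:
  fixes f :: "'i \<Rightarrow> 'v::banach"
  assumes small: "\<And>e. e > 0 \<Longrightarrow> \<exists>G. finite G \<and> G \<subseteq> A \<and>
      (\<forall>F. finite F \<and> F \<subseteq> A - G \<longrightarrow> norm (sum f F) < e)"
  shows "f summable_on A"
proof -
  have "\<exists>P. eventually P (finite_subsets_at_top A) \<and>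
            (\<forall>F F'. P F \<and> P F' \<longrightarrow> dist (sum f F) (sum f F') < e)" if "e > 0" for e
  proof -
    obtain G where G: "finite G" "G \<subseteq> A"
      and less: "\<And>F. finite F \<Longrightarrow> F \<subseteq> A - G \<Longrightarrow> norm (sum f F) < e / 2"
      using small[of "e / 2"] \<open>e > 0\<close> by auto
    \<comment> \<open>Every finite set above \<open>G\<close> has its sum within
      \<open>e / 2\<close> of the sum over \<open>G\<close>, so two such sums differ by less than
      \<open>e\<close>: the net of partial sums is Cauchy.\<close>
    define P where "P F \<longleftrightarrow> finite F \<and> G \<subseteq> F \<and> F \<subseteq> A" for F
    have "eventually P (finite_subsets_at_top A)"
      using G unfolding eventually_finite_subsets_at_top P_def by auto
    moreover have "dist (sum f F) (sum f G) < e / 2" if "P F" for F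
      using that less[of "F - G"] by (auto simp: P_def dist_norm sum_diff)
    ultimately show ?thesis
      by (meson dist_triangle_half_l)
  qed
  then have "cauchy_filter (filtermap (sum f) (finite_subsets_at_top A))"
    by (simp add: cauchy_filter_metric_filtermap)
  moreover have "complete (UNIV::'v set)"
    by (meson Cauchy_convergent UNIV_I complete_def convergent_def)
  ultimately obtain L where "(sum f \<longlongrightarrow> L) (finite_subsets_at_top A)"
    using complete_uniform[where S=UNIV] by (force simp: filterlim_def)
  then show ?thesis
    unfolding summable_on_def has_sum_def by blast
qed

text \<open>Once the partial sum over \<open>G\<close> is within \<open>e\<close> of the total, a
  finite set disjoint from \<open>G\<close> can add less than \<open>e\<close>, since no term is
  negative. This provides the tails that \<open>summable_on_CauchyI\<close> asks for.\<close>

lemma summable_on_nonneg_tail_small: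
  fixes f :: "'i \<Rightarrow> real"
  assumes "f summable_on A" "e > 0" and nonneg: "\<And>i. i \<in> A \<Longrightarrow> f i \<ge> 0"
  shows "\<exists>G. finite G \<and> G \<subseteq> A \<and> (\<forall>F. finite F \<and> F \<subseteq> A - G \<longrightarrow> sum f F < e)"
proof -
  have "(sum f \<longlongrightarrow> infsum f A) (finite_subsets_at_top A)"
    using assms(1) by (simp add: has_sum_infsum has_sum_def[symmetric])
  then have "\<forall>\<^sub>F F in finite_subsets_at_top A. infsum f A - e < sum f F"
    using \<open>e > 0\<close> by (intro order_tendstoD) auto
  then obtain G where G: "finite G" "G \<subseteq> A" "infsum f A - e < sum f G"
    by (auto simp: eventually_finite_subsets_at_top)
  have "sum f F < e" if "finite F" "F \<subseteq> A - G" for F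
  proof -
    have "sum f G + sum f F = sum f (G \<union> F)"
      using that G by (subst sum.union_disjoint) auto
    also have "\<dots> \<le> infsum f A"
      using that G assms by (intro finite_sum_le_infsum) auto
    finally show ?thesis
      using G by simp
  qed
  with G show ?thesis
    by blast
qed

lemma has_sum_diff:
  fixes f g :: "'i \<Rightarrow> 'v::real_normed_vector"
  assumes "(f has_sum a) A" "(g has_sum c) A"
  shows "((\<lambda>i. f i - g i) has_sum (a - c)) A"
  using has_sum_add[OF assms(1) has_sum_bounded_linear[OF bounded_linear_minus[OF bounded_linear_ident] assms(2)]]
  by simp

section \<open>The b-frame product as the adjoint of \<open>h \<mapsto> b h x\<close>, for one
  \<open>x\<close> at a time\<close>

locale b_system = H: hilbert_space_over sH ipH + Z: hilbert_space_over sZ ipZ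
  for sH :: "'k::real_or_complex \<Rightarrow> 'h::banach \<Rightarrow> 'h" and ipH
    and sZ :: "'k \<Rightarrow> 'z::banach \<Rightarrow> 'z" and ipZ +
  fixes b :: "'h \<Rightarrow> 'b \<Rightarrow> 'z"
  assumes b_add: "b (h + h') x = b h x + b h' x"
    and b_scale: "b (sH c h) x = sZ c (b h x)"
    and b_bounded: "\<exists>M. \<forall>h. norm (b h x) \<le> norm h * M"
begin

abbreviation fprod :: "'z \<Rightarrow> 'b \<Rightarrow> 'h" where
  "fprod \<equiv> b_frame_product ipH ipZ b"

lemma bounded_linear_b: "bounded_linear (\<lambda>h. b h x)"
proof -
  obtain M where "\<And>h. norm (b h x) \<le> norm h * M"
    using b_bounded by blast
  then show ?thesis
    by (intro bounded_linear_intro[where K=M]) (auto simp: b_add H.scaleR_scale Z.scaleR_scale b_scale)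
qed

text \<open>Riesz representation of the bounded functional \<open>h \<mapsto> ipZ (b h x) z\<close>.
  Together with \<open>fprod_unique\<close> it shows that the \<open>THE\<close> in
  \<open>b_frame_product\<close> denotes.\<close>

lemma fprod_exists: "\<exists>g. \<forall>h. ipZ (b h x) z = ipH h g"
proof -
  obtain M where M: "\<And>h. norm (b h x) \<le> norm h * M"
    using b_bounded by blast
  have "norm (ipZ (b h x) z) \<le> (M * norm z) * norm h" for h
    using Z.Cauchy_Schwarz[of "b h x" z] mult_right_mono[OF M[of h] norm_ge_zero[of z]]
    by (simp add: mult_ac)
  then show ?thesis
    by (intro H.Riesz_representation) (auto simp: b_add b_scale Z.ip_add_left Z.ip_scale_left)
qed

lemma fprod_unique:
  assumes "\<And>h. ipZ (b h x) z = ipH h g"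
  shows "fprod z x = g"
  unfolding b_frame_product_def
proof (rule the_equality)
  fix g' assume "\<forall>h. ipZ (b h x) z = ipH h g'"
  with assms show "g' = g"
    by (intro H.ip_ext) metis
qed (use assms in blast)

lemma fprod_adjoint: "ipZ (b h x) z = ipH h (fprod z x)"
  using fprod_exists fprod_unique by metis

lemma fprod_add: "fprod (y + z) x = fprod y x + fprod z x"
  by (rule fprod_unique) (simp add: Z.ip_add_right H.ip_add_right fprod_adjoint)

text \<open>Both inner products are conjugate-linear in the second argument, so the conjugates
  cancel and the b-frame product is linear in \<open>z\<close>.\<close>

lemma fprod_scale: "fprod (sZ c z) x = sH c (fprod z x)"
  by (rule fprod_unique) (simp add: Z.ip_scale_right H.ip_scale_right fprod_adjoint)

text \<open>An adjoint inherits the bound \<open>M\<close> of the operator: test the adjoint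
  identity with \<open>h\<close> equal to the b-frame product itself and cancel one factor of its
  norm.\<close>

lemma bounded_linear_fprod: "bounded_linear (\<lambda>z. fprod z x)"
proof -
  obtain M where "M \<ge> 0" and M: "\<And>h. norm (b h x) \<le> norm h * M"
    using bounded_linear.nonneg_bounded[OF bounded_linear_b] by blast
  have "norm (fprod z x) \<le> norm z * M" for z
  proof (cases "fprod z x = 0")
    case False
    define g where "g = fprod z x"
    have "norm g * norm g = norm (ipZ (b g x) z)"
      by (simp add: fprod_adjoint g_def[symmetric] H.norm_eq_ip power2_eq_square)
    also have "\<dots> \<le> norm (b g x) * norm z"
      by (rule Z.Cauchy_Schwarz)
    also have "\<dots> \<le> norm g * M * norm z"
      by (rule mult_right_mono[OF M norm_ge_zero])
    finally show ?thesis
      using False by (simp add: g_def mult_ac)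
  qed (use \<open>M \<ge> 0\<close> in simp)
  then show ?thesis
    by (intro bounded_linear_intro[where K=M]) (auto simp: fprod_add H.scaleR_scale Z.scaleR_scale fprod_scale)
qed

lemmas fprod_diff = linear_diff[OF bounded_linear.linear[OF bounded_linear_fprod]]
lemmas fprod_sum = linear_sum[OF bounded_linear.linear[OF bounded_linear_fprod]]

section \<open>Analysis and synthesis bounds, and surjectivity of the frame operator\<close>

lemma frame_partial_sum_le:
  assumes "b_frame_with_bounds ipH ipZ b K x A B" "finite F" "F \<subseteq> K"
  shows "(\<Sum>k\<in>F. (norm (fprod z (x k)))\<^sup>2) \<le> B * (norm z)\<^sup>2"
proof -
  have "(\<Sum>k\<in>F. (norm (fprod z (x k)))\<^sup>2) \<le> (\<Sum>\<^sub>\<infinity>k\<in>K. (norm (fprod z (x k)))\<^sup>2)"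
    using assms by (intro finite_sum_le_infsum) (auto simp: b_frame_with_bounds_def)
  also have "\<dots> \<le> B * (norm z)\<^sup>2"
    using assms(1) by (simp add: b_frame_with_bounds_def)
  finally show ?thesis .
qed

text \<open>Dual form of the upper frame bound. The squared norm of the sum \<open>w\<close> pairs
  the coefficients \<open>c\<close> with the b-frame products of \<open>w\<close>; Cauchy-Schwarz
  and the frame bound on the latter leave a common factor to cancel.\<close>

lemma frame_synthesis_bound:
  assumes frame: "b_frame_with_bounds ipH ipZ b K x A B" and F: "finite F" "F \<subseteq> K"
  shows "(norm (\<Sum>k\<in>F. b (c k) (x k)))\<^sup>2 \<le> B * (\<Sum>k\<in>F. (norm (c k))\<^sup>2)"
proof -
  define w where "w = (\<Sum>k\<in>F. b (c k) (x k))"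
  let ?c = "L2_set (\<lambda>k. norm (c k)) F" and ?p = "L2_set (\<lambda>k. norm (fprod w (x k))) F"
  have "(norm w)\<^sup>2 = norm (\<Sum>k\<in>F. ipH (c k) (fprod w (x k)))"
    unfolding Z.norm_eq_ip[symmetric] by (subst w_def) (simp add: Z.ip_sum_left fprod_adjoint)
  also have "\<dots> \<le> (\<Sum>k\<in>F. \<bar>norm (c k)\<bar> * \<bar>norm (fprod w (x k))\<bar>)"
    by (rule sum_norm_le) (simp add: H.Cauchy_Schwarz)
  also have "\<dots> \<le> ?c * ?p"
    by (rule L2_set_mult_ineq)
  finally have "((norm w)\<^sup>2)\<^sup>2 \<le> ?c\<^sup>2 * ?p\<^sup>2"
    using power_mono[of "(norm w)\<^sup>2" "?c * ?p" 2] by (simp add: power_mult_distrib)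
  also have "\<dots> \<le> ?c\<^sup>2 * (B * (norm w)\<^sup>2)"
    using frame_partial_sum_le[OF frame F, of w] by (intro mult_left_mono) (auto simp: L2_set_def sum_nonneg)
  finally have "(norm w)\<^sup>2 * (norm w)\<^sup>2 \<le> (B * ?c\<^sup>2) * (norm w)\<^sup>2"
    by (simp add: power2_eq_square mult_ac)
  then have "(norm w)\<^sup>2 \<le> B * ?c\<^sup>2" if "w \<noteq> 0"
    using that by (elim mult_right_le_imp_le) simp
  moreover have "0 \<le> B * ?c\<^sup>2"
    using frame by (simp add: b_frame_with_bounds_def)
  ultimately show ?thesis
    by (cases "w = 0") (auto simp: w_def[symmetric] L2_set_def sum_nonneg)
qed

definition frame_operator :: "'i set \<Rightarrow> ('i \<Rightarrow> 'b) \<Rightarrow> 'z \<Rightarrow> 'z" where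
  "frame_operator K x z = (\<Sum>\<^sub>\<infinity>k\<in>K. b (fprod z (x k)) (x k))"

text \<open>The synthesis bound, with the b-frame products as coefficients, turns small tails of the
  scalar frame series into small tails of this vector series.\<close>

lemma has_sum_frame_operator:
  assumes frame: "b_frame_with_bounds ipH ipZ b K x A B"
  shows "((\<lambda>k. b (fprod z (x k)) (x k)) has_sum frame_operator K x z) K"
  unfolding frame_operator_def
proof (intro has_sum_infsum summable_on_CauchyI)
  fix e :: real assume "e > 0"
  have "B > 0"
    using frame by (simp add: b_frame_with_bounds_def)
  obtain G where G: "finite G" "G \<subseteq> K"
    and less: "\<And>F. finite F \<Longrightarrow> F \<subseteq> K - G \<Longrightarrow> (\<Sum>k\<in>F. (norm (fprod z (x k)))\<^sup>2) < e\<^sup>2 / B"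
    using summable_on_nonneg_tail_small[of "\<lambda>k. (norm (fprod z (x k)))\<^sup>2" K "e\<^sup>2 / B"]
      frame \<open>e > 0\<close> \<open>B > 0\<close> by (auto simp: b_frame_with_bounds_def)
  have "norm (\<Sum>k\<in>F. b (fprod z (x k)) (x k)) < e" if F: "finite F" "F \<subseteq> K - G" for F
  proof -
    have "F \<subseteq> K"
      using F by blast
    from frame_synthesis_bound[OF frame F(1) this, of "\<lambda>k. fprod z (x k)"] less[OF F]
    have "(norm (\<Sum>k\<in>F. b (fprod z (x k)) (x k)))\<^sup>2 < e\<^sup>2"
      using \<open>B > 0\<close> by (simp add: field_simps)
    then show ?thesis
      using \<open>e > 0\<close> by (intro power2_less_imp_less[of _ e]) auto
  qed
  with G show "\<exists>G. finite G \<and> G \<subseteq> K \<and>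
      (\<forall>F. finite F \<and> F \<subseteq> K - G \<longrightarrow> norm (\<Sum>k\<in>F. b (fprod z (x k)) (x k)) < e)"
    by blast
qed

lemma frame_operator_diff:
  assumes frame: "b_frame_with_bounds ipH ipZ b K x A B"
  shows "frame_operator K x (y - z) = frame_operator K x y - frame_operator K x z"
proof -
  have b_diff: "b (g - h) x = b g x - b h x" for g h x
    using linear_diff[OF bounded_linear.linear[OF bounded_linear_b]] .
  have "((\<lambda>k. b (fprod (y - z) (x k)) (x k)) has_sum (frame_operator K x y - frame_operator K x z)) K"
    using has_sum_diff[OF has_sum_frame_operator[OF frame, of y] has_sum_frame_operator[OF frame, of z]]
    by (simp add: fprod_diff b_diff)
  with has_sum_frame_operator[OF frame] show ?thesis
    by (rule has_sum_unique)
qed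

text \<open>The upper frame bound is spent twice, on synthesis and on the coefficients; each use
  costs \<open>sqrt B\<close>. The estimate for finite partial sums passes to the limit.\<close>

lemma norm_frame_operator_le:
  assumes frame: "b_frame_with_bounds ipH ipZ b K x A B"
  shows "norm (frame_operator K x z) \<le> B * norm z"
proof -
  have "B > 0"
    using frame by (simp add: b_frame_with_bounds_def)
  have le: "norm (\<Sum>k\<in>F. b (fprod z (x k)) (x k)) \<le> B * norm z" if F: "finite F" "F \<subseteq> K" for F
  proof -
    have "(norm (\<Sum>k\<in>F. b (fprod z (x k)) (x k)))\<^sup>2 \<le> B * (B * (norm z)\<^sup>2)"
      using frame_synthesis_bound[OF frame F, of "\<lambda>k. fprod z (x k)"]
        mult_left_mono[OF frame_partial_sum_le[OF frame F, of z], of B] \<open>B > 0\<close> by linarith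
    then have "(norm (\<Sum>k\<in>F. b (fprod z (x k)) (x k)))\<^sup>2 \<le> (B * norm z)\<^sup>2"
      by (simp add: power2_eq_square mult_ac)
    then show ?thesis
      by (rule power2_le_imp_le) (use \<open>B > 0\<close> in simp)
  qed
  show ?thesis
  proof (rule tendsto_upperbound)
    show "((\<lambda>F. norm (\<Sum>k\<in>F. b (fprod z (x k)) (x k))) \<longlongrightarrow> norm (frame_operator K x z)) (finite_subsets_at_top K)"
      using has_sum_frame_operator[OF frame, of z] unfolding has_sum_def by (rule tendsto_norm)
    show "\<forall>\<^sub>F F in finite_subsets_at_top K. norm (\<Sum>k\<in>F. b (fprod z (x k)) (x k)) \<le> B * norm z"
      using le by (intro eventually_finite_subsets_at_top_weakI) auto
  qed simp
qed

text \<open>By adjointness each term of the series pairs with \<open>z\<close> to a squared norm.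
  The lower frame bound thereby becomes coercivity of the frame operator.\<close>

lemma ip_frame_operator:
  assumes frame: "b_frame_with_bounds ipH ipZ b K x A B"
  shows "ipZ (frame_operator K x z) z = of_real (\<Sum>\<^sub>\<infinity>k\<in>K. (norm (fprod z (x k)))\<^sup>2)"
proof -
  have "((\<lambda>k. ipZ (b (fprod z (x k)) (x k)) z) has_sum ipZ (frame_operator K x z) z) K"
    using has_sum_frame_operator[OF frame] by (rule has_sum_bounded_linear[OF Z.bounded_linear_ip_left])
  moreover have "((\<lambda>k. of_real ((norm (fprod z (x k)))\<^sup>2) :: 'k) has_sum
      of_real (\<Sum>\<^sub>\<infinity>k\<in>K. (norm (fprod z (x k)))\<^sup>2)) K"
    using frame by (intro has_sum_of_real has_sum_infsum) (simp add: b_frame_with_bounds_def)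
  ultimately show ?thesis
    by (simp add: fprod_adjoint H.ip_self has_sum_unique del: of_real_power)
qed

text \<open>\<open>y \<mapsto> y + t (w - S y)\<close> is a contraction for \<open>t = A / B\<^sup>2\<close>; its fixed point solves \<open>S y = w\<close>.\<close>

lemma frame_operator_surj:
  assumes frame: "b_frame_with_bounds ipH ipZ b K x A B"
  shows "\<exists>y. frame_operator K x y = w"
proof -
  let ?S = "frame_operator K x"
  have pos: "A > 0" "B > 0"
    using frame by (auto simp: b_frame_with_bounds_def)
  define t where "t = A / B\<^sup>2"
  have "t > 0"
    using pos by (simp add: t_def)
  \<comment> \<open>On the zero space \<open>A\<close> may exceed \<open>B\<close>;
    \<open>max 0\<close> keeps \<open>q\<close> nonnegative there.\<close>
  define q where "q = sqrt (max 0 (1 - A\<^sup>2 / B\<^sup>2))"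
  have q: "0 \<le> q" "q < 1" "q\<^sup>2 \<ge> 1 - A\<^sup>2 / B\<^sup>2"
    using pos by (auto simp: q_def)
  have contract: "norm (z - t *\<^sub>R ?S z) \<le> q * norm z" for z
  proof -
    define s where "s = (\<Sum>\<^sub>\<infinity>k\<in>K. (norm (fprod z (x k)))\<^sup>2)"
    have s: "ipZ (?S z) z = of_real s"
      unfolding s_def by (rule ip_frame_operator[OF frame])
    then have s': "ipZ z (?S z) = of_real s"
      using Z.ip_commute[of z "?S z"] by (simp add: scalar_cnj_of_real)
    have "(of_real ((norm (z - t *\<^sub>R ?S z))\<^sup>2) :: 'k)
        = of_real ((norm z)\<^sup>2 - 2 * t * s + t\<^sup>2 * (norm (?S z))\<^sup>2)"
      unfolding Z.ip_self[symmetric] of_real_add of_real_diff of_real_mult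
      by (simp add: Z.ip_diff_left Z.ip_diff_right Z.ip_scaleR_left Z.ip_scaleR_right s s'
          algebra_simps power2_eq_square)
    then have "(norm (z - t *\<^sub>R ?S z))\<^sup>2 = (norm z)\<^sup>2 - 2 * t * s + t\<^sup>2 * (norm (?S z))\<^sup>2"
      by (simp only: of_real_eq_iff)
    \<comment> \<open>The lower frame bound enters the cross term and the operator bound the last
      one. The chosen \<open>t\<close> minimizes the resulting factor
      \<open>1 - 2 * t * A + t^2 * B^2\<close>.\<close>
    also have "\<dots> \<le> (norm z)\<^sup>2 - 2 * t * (A * (norm z)\<^sup>2) + t\<^sup>2 * (B * norm z)\<^sup>2"
      using \<open>t > 0\<close> frame norm_frame_operator_le[OF frame, of z]
      by (intro add_mono diff_mono mult_left_mono power_mono)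
        (auto simp: s_def b_frame_with_bounds_def)
    also have "\<dots> = (1 - A\<^sup>2 / B\<^sup>2) * (norm z)\<^sup>2"
      using pos by (simp add: t_def field_simps power2_eq_square)
    also have "\<dots> \<le> (q * norm z)\<^sup>2"
      unfolding power_mult_distrib using q by (intro mult_right_mono) auto
    finally show ?thesis
      by (rule power2_le_imp_le) (use q in simp)
  qed
  have "\<forall>y z. dist (y + t *\<^sub>R (w - ?S y)) (z + t *\<^sub>R (w - ?S z)) \<le> q * dist y z"
  proof (intro allI)
    fix y z
    have "y + t *\<^sub>R (w - ?S y) - (z + t *\<^sub>R (w - ?S z)) = (y - z) - t *\<^sub>R ?S (y - z)"
      by (simp add: frame_operator_diff[OF frame] algebra_simps)
    then show "dist (y + t *\<^sub>R (w - ?S y)) (z + t *\<^sub>R (w - ?S z)) \<le> q * dist y z"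
      using contract[of "y - z"] unfolding dist_norm by (simp only:)
  qed
  then obtain y where "y + t *\<^sub>R (w - ?S y) = y"
    using banach_fix_type[OF q(1,2), of "\<lambda>y. y + t *\<^sub>R (w - ?S y)"] by blast
  then show ?thesis
    using \<open>t > 0\<close> by auto
qed

section \<open>Uniqueness of expansions and dual vectors\<close>

lemma b_basis_zero_coeff:
  assumes basis: "b_basis b K x" and sum: "((\<lambda>k. b (h k) (x k)) has_sum 0) K" and "j \<in> K"
  shows "h j = 0"
proof -
  have b0: "b 0 x = 0" for x
    using linear_0[OF bounded_linear.linear[OF bounded_linear_b]] .
  \<comment> \<open>Coefficient families are compared as elements of \<open>extensional K\<close>,
    so both \<open>h\<close> and the zero family are restricted to \<open>K\<close> first.\<close>
  have "((\<lambda>k. b (restrict h K k) (x k)) has_sum 0) K"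
    using sum by (rule has_sum_cong[THEN iffD1, rotated]) simp
  moreover have "((\<lambda>k. b (restrict (\<lambda>_. 0) K k) (x k)) has_sum 0) K"
    by (rule has_sum_cong[THEN iffD2, OF _ has_sum_0]) (auto simp: b0)
  ultimately have "restrict h K = restrict (\<lambda>_. 0) K"
    using basis unfolding b_basis_def by (metis restrict_extensional)
  then show ?thesis
    using \<open>j \<in> K\<close> by (metis restrict_apply')
qed

text \<open>Solving \<open>S y = z\<close> for the frame operator \<open>S\<close> expands
  \<open>z\<close> with the b-frame products of \<open>y\<close> as coefficients. For a b-frame it
  thus remains to exclude nontrivial expansions of zero.\<close>

lemma b_basis_frameI:
  assumes frame: "b_frame_with_bounds ipH ipZ b K x A B"
    and zero: "\<And>h j. ((\<lambda>k. b (h k) (x k)) has_sum 0) K \<Longrightarrow> j \<in> K \<Longrightarrow> h j = 0"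
  shows "b_basis b K x"
  unfolding b_basis_def
proof (intro allI ex_ex1I)
  fix z
  obtain y where y: "frame_operator K x y = z"
    using frame_operator_surj[OF frame] by blast
  have "((\<lambda>k. b (restrict (\<lambda>k. fprod y (x k)) K k) (x k)) has_sum z) K"
    using has_sum_frame_operator[OF frame, of y] unfolding y
    by (rule has_sum_cong[THEN iffD1, rotated]) simp
  then show "\<exists>h. h \<in> extensional K \<and> ((\<lambda>k. b (h k) (x k)) has_sum z) K"
    using restrict_extensional by blast
next
  fix z g h
  assume g: "g \<in> extensional K \<and> ((\<lambda>k. b (g k) (x k)) has_sum z) K"
    and h: "h \<in> extensional K \<and> ((\<lambda>k. b (h k) (x k)) has_sum z) K"
  have "((\<lambda>k. b (g k - h k) (x k)) has_sum 0) K"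
    using has_sum_diff[of "\<lambda>k. b (g k) (x k)" K z "\<lambda>k. b (h k) (x k)" z] g h
    by (simp add: linear_diff[OF bounded_linear.linear[OF bounded_linear_b]])
  then have "g k = h k" if "k \<in> K" for k
    using zero[of "\<lambda>k. g k - h k" k] that by simp
  then show "g = h"
    using g h by (auto intro: extensionalityI)
qed

text \<open>Solve \<open>S y = b g (x j)\<close>. The right side has two expansions, one with the
  b-frame products of \<open>y\<close> and one with the single coefficient \<open>g\<close> at
  \<open>j\<close>; uniqueness identifies them.\<close>

lemma b_riesz_basis_dual:
  assumes "b_riesz_basis ipH ipZ b K x" and "j \<in> K"
  shows "\<exists>y. \<forall>k\<in>K. fprod y (x k) = (if k = j then g else 0)"
proof -
  obtain A B where frame: "b_frame_with_bounds ipH ipZ b K x A B"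
    using assms(1) unfolding b_riesz_basis_def b_frame_def by blast
  obtain y where y: "frame_operator K x y = b g (x j)"
    using frame_operator_surj[OF frame] by blast
  have b0: "b 0 x = 0" for x
    using linear_0[OF bounded_linear.linear[OF bounded_linear_b]] .
  have "((\<lambda>k. b (if k = j then g else 0) (x k)) has_sum b g (x j)) K"
    using \<open>j \<in> K\<close> by (intro has_sum_finite_neutralI[of "{j}"]) (auto simp: b0)
  from has_sum_diff[OF has_sum_frame_operator[OF frame, of y] this]
  have "((\<lambda>k. b (fprod y (x k) - (if k = j then g else 0)) (x k)) has_sum 0) K"
    by (simp add: linear_diff[OF bounded_linear.linear[OF bounded_linear_b]] y)
  moreover have "b_basis b K x"
    using assms by (simp add: b_riesz_basis_def)
  ultimately have "fprod y (x k) - (if k = j then g else 0) = 0" if "k \<in> K" for k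
    using b_basis_zero_coeff[where h="\<lambda>k. fprod y (x k) - (if k = j then g else 0)"] that by blast
  then show ?thesis
    by (intro exI[of _ y] ballI) simp
qed

end

section \<open>Gram pairings and frame bounds\<close>

text \<open>Gram-Schmidt by induction: split off the components along the last vector. The
  remainders are orthogonal to it and the last remainder is zero, so the induction hypothesis covers
  the others.\<close>

lemma (in hilbert_space_over) Gram_factorization:
  fixes n :: nat and a :: "nat \<Rightarrow> 'v"
  shows "\<exists>(m::nat) \<alpha>. \<forall>i<n. \<forall>j<n. ip (a i) (a j) = (\<Sum>l<m. \<alpha> i l * scalar_cnj (\<alpha> j l))"
proof (induction n arbitrary: a)
  case (Suc n)
  \<comment> \<open>If \<open>a n = 0\<close> then also \<open>e = 0\<close>, so \<open>e\<close>
    need not be a unit vector; \<open>ee\<close> is the identity that holds in both cases.\<close>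
  define e where "e = (1 / norm (a n)) *\<^sub>R a n"
  have ee: "ip x e * ip e e = ip x e" for x
    by (cases "a n = 0") (auto simp: e_def ip_scaleR_left ip_scaleR_right ip_self power2_eq_square)
  have e_cnj: "scalar_cnj (ip x e) = ip e x" for x
    by (rule ip_commute[symmetric])
  define a' where "a' i = a i - scale (ip (a i) e) e" for i
  have "ip (a n) e = of_real (norm (a n))"
    by (cases "a n = 0") (auto simp: e_def ip_scaleR_right ip_self power2_eq_square)
  then have a'_n: "a' n = 0"
    by (cases "a n = 0") (auto simp: a'_def scaleR_scale[symmetric] e_def)
  have split: "ip (a i) (a j) = ip (a' i) (a' j) + ip (a i) e * scalar_cnj (ip (a j) e)" for i j
  proof -
    have "ip (a' i) (a' j) = ip (a i) (a j) - ip (a i) e * ip e (a j)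
        - scalar_cnj (ip (a j) e) * ip (a i) e + scalar_cnj (ip (a j) e) * (ip (a i) e * ip e e)"
      by (simp add: a'_def ip_diff_left ip_diff_right ip_scale_left ip_scale_right algebra_simps)
    then show ?thesis
      by (simp only: ee e_cnj) (simp add: mult.commute)
  qed
  obtain m :: nat and \<alpha> where
    \<alpha>: "\<And>i j. i < n \<Longrightarrow> j < n \<Longrightarrow> ip (a' i) (a' j) = (\<Sum>l<m. \<alpha> i l * scalar_cnj (\<alpha> j l))"
    using Suc.IH[of a'] by blast
  \<comment> \<open>The new column \<open>m\<close> holds the components along \<open>e\<close>; row
    \<open>n\<close> of the old columns is zero because \<open>a' n = 0\<close>.\<close>
  define \<beta> where "\<beta> i l = (if l = m then ip (a i) e else if i = n then 0 else \<alpha> i l)" for i l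
  have "ip (a i) (a j) = (\<Sum>l<Suc m. \<beta> i l * scalar_cnj (\<beta> j l))" if "i < Suc n" "j < Suc n" for i j
  proof -
    have "ip (a' i) (a' j) = (\<Sum>l<m. \<beta> i l * scalar_cnj (\<beta> j l))"
      using that \<alpha>[of i j] a'_n by (cases "i = n"; cases "j = n") (auto simp: \<beta>_def)
    then show ?thesis
      by (simp add: split[of i j] \<beta>_def)
  qed
  then show ?case
    by blast
qed simp

text \<open>This is the squared norm of the sum of the tensors of \<open>u i\<close> and
  \<open>v i\<close>, written without a tensor product so that it also makes sense for mixed pairs
  of spaces. For inner products the double sum is already a nonnegative real; \<open>norm\<close>
  turns it into type \<open>real\<close>.\<close>

definition gram_pairing ::
  "('u \<Rightarrow> 'u \<Rightarrow> 'k::real_or_complex) \<Rightarrow> ('v \<Rightarrow> 'v \<Rightarrow> 'k) \<Rightarrow> nat \<Rightarrow> (nat \<Rightarrow> 'u) \<Rightarrow> (nat \<Rightarrow> 'v) \<Rightarrow> real" where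
  "gram_pairing ipU ipV n u v = norm (\<Sum>i<n. \<Sum>j<n. ipU (u i) (u j) * ipV (v i) (v j))"

lemma gram_pairing_commute: "gram_pairing ipU ipV n u v = gram_pairing ipV ipU n v u"
  by (simp add: gram_pairing_def mult.commute)

text \<open>Insert the factorization and move the sum over \<open>l\<close> outside: for fixed
  \<open>l\<close> the double sum is the inner product of one combination of the \<open>v i\<close>
  with itself.\<close>

lemma (in hilbert_space_over) gram_pairing_squares:
  fixes m :: nat
  assumes "\<forall>i<n. \<forall>j<n. ipU (u i) (u j) = (\<Sum>l<m. \<alpha> i l * scalar_cnj (\<alpha> j l))"
  shows "gram_pairing ipU ip n u v = (\<Sum>l<m. (norm (\<Sum>i<n. scale (\<alpha> i l) (v i)))\<^sup>2)"
proof -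
  have "(\<Sum>i<n. \<Sum>j<n. ipU (u i) (u j) * ip (v i) (v j))
      = (\<Sum>i<n. \<Sum>j<n. \<Sum>l<m. \<alpha> i l * scalar_cnj (\<alpha> j l) * ip (v i) (v j))"
    using assms by (intro sum.cong refl) (simp add: sum_distrib_right)
  also have "\<dots> = (\<Sum>i<n. \<Sum>l<m. \<Sum>j<n. \<alpha> i l * scalar_cnj (\<alpha> j l) * ip (v i) (v j))"
    by (intro sum.cong refl sum.swap)
  also have "\<dots> = (\<Sum>l<m. \<Sum>i<n. \<Sum>j<n. \<alpha> i l * scalar_cnj (\<alpha> j l) * ip (v i) (v j))"
    by (rule sum.swap)
  also have "\<dots> = (\<Sum>l<m. of_real ((norm (\<Sum>i<n. scale (\<alpha> i l) (v i)))\<^sup>2))"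
    unfolding ip_self[symmetric] ip_sum_left unfolding ip_sum_right
    by (simp add: ip_scale_left ip_scale_right mult_ac)
  also have "\<dots> = of_real (\<Sum>l<m. (norm (\<Sum>i<n. scale (\<alpha> i l) (v i)))\<^sup>2)"
    by simp
  finally show ?thesis
    by (simp only: gram_pairing_def norm_of_real) (simp add: sum_nonneg)
qed

lemma has_sum_finite_sum:
  fixes f :: "'l \<Rightarrow> 'i \<Rightarrow> 'v::topological_comm_monoid_add"
  assumes "\<And>l. l \<in> L \<Longrightarrow> (f l has_sum s l) A"
  shows "((\<lambda>i. \<Sum>l\<in>L. f l i) has_sum (\<Sum>l\<in>L. s l)) A"
  using assms by (induction L rule: infinite_finite_induct) (auto intro: has_sum_add)

text \<open>Passing to a Gram factorization of \<open>u\<close> applies the frame inequality in one tensor factor.\<close>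

lemma (in b_system) gram_pairing_frame:
  assumes "hilbert_space_over sU ipU" and frame: "b_frame_with_bounds ipH ipZ b K x A B"
  shows "(\<lambda>k. gram_pairing ipU ipH n u (\<lambda>i. fprod (v i) (x k))) summable_on K"
    and "A * gram_pairing ipU ipZ n u v
      \<le> (\<Sum>\<^sub>\<infinity>k\<in>K. gram_pairing ipU ipH n u (\<lambda>i. fprod (v i) (x k)))"
    and "(\<Sum>\<^sub>\<infinity>k\<in>K. gram_pairing ipU ipH n u (\<lambda>i. fprod (v i) (x k)))
      \<le> B * gram_pairing ipU ipZ n u v"
proof -
  interpret U: hilbert_space_over sU ipU by fact
  obtain m :: nat and \<alpha> where
    \<alpha>: "\<forall>i<n. \<forall>j<n. ipU (u i) (u j) = (\<Sum>l<m. \<alpha> i l * scalar_cnj (\<alpha> j l))"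
    using U.Gram_factorization by blast
  define w where "w l = (\<Sum>i<n. sZ (\<alpha> i l) (v i))" for l
  have Z: "gram_pairing ipU ipZ n u v = (\<Sum>l<m. (norm (w l))\<^sup>2)"
    unfolding w_def by (rule Z.gram_pairing_squares[where ipU=ipU and n=n and u=u and m=m and \<alpha>=\<alpha>, OF \<alpha>])
  have H: "gram_pairing ipU ipH n u (\<lambda>i. fprod (v i) (x k)) = (\<Sum>l<m. (norm (fprod (w l) (x k)))\<^sup>2)" for k
    using H.gram_pairing_squares[where ipU=ipU and n=n and u=u and m=m and \<alpha>=\<alpha>, OF \<alpha>, of "\<lambda>i. fprod (v i) (x k)"]
    by (simp add: w_def fprod_sum fprod_scale)
  have has_sum: "((\<lambda>k. \<Sum>l<m. (norm (fprod (w l) (x k)))\<^sup>2) has_sum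
      (\<Sum>l<m. \<Sum>\<^sub>\<infinity>k\<in>K. (norm (fprod (w l) (x k)))\<^sup>2)) K"
    using frame by (intro has_sum_finite_sum has_sum_infsum) (auto simp: b_frame_with_bounds_def)
  then show "(\<lambda>k. gram_pairing ipU ipH n u (\<lambda>i. fprod (v i) (x k))) summable_on K"
    unfolding H by (rule has_sum_imp_summable)
  have sum: "(\<Sum>\<^sub>\<infinity>k\<in>K. gram_pairing ipU ipH n u (\<lambda>i. fprod (v i) (x k)))
      = (\<Sum>l<m. \<Sum>\<^sub>\<infinity>k\<in>K. (norm (fprod (w l) (x k)))\<^sup>2)"
    unfolding H using has_sum by (rule infsumI)
  show "A * gram_pairing ipU ipZ n u v
      \<le> (\<Sum>\<^sub>\<infinity>k\<in>K. gram_pairing ipU ipH n u (\<lambda>i. fprod (v i) (x k)))"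
    unfolding sum Z sum_distrib_left using frame by (intro sum_mono) (simp add: b_frame_with_bounds_def)
  show "(\<Sum>\<^sub>\<infinity>k\<in>K. gram_pairing ipU ipH n u (\<lambda>i. fprod (v i) (x k)))
      \<le> B * gram_pairing ipU ipZ n u v"
    unfolding sum Z sum_distrib_left using frame by (intro sum_mono) (simp add: b_frame_with_bounds_def)
qed

text \<open>Nonnegative terms allow iterated summation. The inner sums are compared with
  \<open>g\<close> and the sum of \<open>g\<close> with \<open>c\<close>, so the constants
  multiply.\<close>

lemma iterated_infsum_bounds:
  fixes f :: "'i \<Rightarrow> 'j \<Rightarrow> real"
  assumes f: "\<And>i j. f i j \<ge> 0" and fsum: "\<And>i. i \<in> I \<Longrightarrow> f i summable_on J"
    and f_lower: "\<And>i. i \<in> I \<Longrightarrow> A2 * g i \<le> infsum (f i) J"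
    and f_upper: "\<And>i. i \<in> I \<Longrightarrow> infsum (f i) J \<le> B2 * g i"
    and gsum: "g summable_on I" and g_lower: "A1 * c \<le> infsum g I" and g_upper: "infsum g I \<le> B1 * c"
    and pos: "A2 > 0" "B2 > 0"
  shows "(\<lambda>(i, j). f i j) summable_on (I \<times> J) \<and> A1 * A2 * c \<le> (\<Sum>\<^sub>\<infinity>(i, j)\<in>I \<times> J. f i j) \<and>
      (\<Sum>\<^sub>\<infinity>(i, j)\<in>I \<times> J. f i j) \<le> B1 * B2 * c"
proof (intro conjI)
  let ?F = "\<lambda>i. infsum (f i) J"
  have Fsum: "?F summable_on I"
    by (rule summable_on_comparison_test[OF summable_on_cmult_right[OF gsum, of B2]])
      (use f f_upper in \<open>auto intro: infsum_nonneg\<close>)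
  show summable: "(\<lambda>(i, j). f i j) summable_on (I \<times> J)"
    by (rule summable_on_SigmaI[where g="?F"]) (use f fsum Fsum in auto)
  have eq: "(\<Sum>\<^sub>\<infinity>(i, j)\<in>I \<times> J. f i j) = infsum ?F I"
    using infsum_Sigma'_banach[OF summable] by simp
  have "A1 * A2 * c \<le> A2 * infsum g I"
    using mult_left_mono[OF g_lower, of A2] pos by (simp add: mult_ac)
  also have "\<dots> = (\<Sum>\<^sub>\<infinity>i\<in>I. A2 * g i)"
    by (rule infsum_cmult_right'[symmetric])
  also have "\<dots> \<le> infsum ?F I"
    by (intro infsum_mono summable_on_cmult_right gsum Fsum f_lower)
  finally show "A1 * A2 * c \<le> (\<Sum>\<^sub>\<infinity>(i, j)\<in>I \<times> J. f i j)"
    unfolding eq .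
  have "infsum ?F I \<le> (\<Sum>\<^sub>\<infinity>i\<in>I. B2 * g i)"
    by (intro infsum_mono summable_on_cmult_right gsum Fsum f_upper)
  also have "\<dots> = B2 * infsum g I"
    by (rule infsum_cmult_right')
  also have "\<dots> \<le> B1 * B2 * c"
    using mult_left_mono[OF g_upper, of B2] pos by (simp add: mult_ac)
  finally show "(\<Sum>\<^sub>\<infinity>(i, j)\<in>I \<times> J. f i j) \<le> B1 * B2 * c"
    unfolding eq .
qed

section \<open>Frame bounds by density and from product series; isolating coefficients\<close>

context b_system
begin

text \<open>Finite partial sums are continuous in \<open>z\<close>, so the upper bound extends to
  the closure and yields summability. The lower bound needs continuity of the whole series, which
  the extended upper bound provides.\<close>

lemma b_frame_with_bounds_dense:
  assumes dense: "closure D = UNIV" and pos: "A > 0" "B > 0"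
    and summable: "\<And>z. z \<in> D \<Longrightarrow> (\<lambda>k. (norm (fprod z (x k)))\<^sup>2) summable_on K"
    and lower: "\<And>z. z \<in> D \<Longrightarrow> A * (norm z)\<^sup>2 \<le> (\<Sum>\<^sub>\<infinity>k\<in>K. (norm (fprod z (x k)))\<^sup>2)"
    and upper: "\<And>z. z \<in> D \<Longrightarrow> (\<Sum>\<^sub>\<infinity>k\<in>K. (norm (fprod z (x k)))\<^sup>2) \<le> B * (norm z)\<^sup>2"
  shows "b_frame_with_bounds ipH ipZ b K x A B"
proof -
  have UNIV_I: "z \<in> C" if "closed C" "D \<subseteq> C" for C z
    using closure_minimal[OF that(2,1)] dense by auto
  have cont: "continuous_on UNIV (\<lambda>z. fprod z (x k))" for k
    by (rule linear_continuous_on[OF bounded_linear_fprod])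
  have partial: "(\<Sum>k\<in>F. (norm (fprod z (x k)))\<^sup>2) \<le> B * (norm z)\<^sup>2" if F: "finite F" "F \<subseteq> K" for F z
  proof -
    have "closed {z. (\<Sum>k\<in>F. (norm (fprod z (x k)))\<^sup>2) \<le> B * (norm z)\<^sup>2}"
      by (intro closed_Collect_le continuous_intros cont)
    moreover have "D \<subseteq> {z. (\<Sum>k\<in>F. (norm (fprod z (x k)))\<^sup>2) \<le> B * (norm z)\<^sup>2}"
      using finite_sum_le_infsum[OF summable F] upper order_trans by fastforce
    ultimately show ?thesis
      using UNIV_I by blast
  qed
  have summable': "(\<lambda>k. (norm (fprod z (x k)))\<^sup>2) summable_on K" for z
    by (rule nonneg_bdd_above_summable_on) (auto intro!: bdd_aboveI2 partial)
  have upper': "(\<Sum>\<^sub>\<infinity>k\<in>K. (norm (fprod z (x k)))\<^sup>2) \<le> B * (norm z)\<^sup>2" for z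
    by (rule infsum_le_finite_sums[OF summable' partial])
  have "A * (norm z)\<^sup>2 \<le> (\<Sum>\<^sub>\<infinity>k\<in>K. (norm (fprod z (x k)))\<^sup>2)" (is "_ \<le> ?R") for z
  proof -
    have R: "?R \<ge> 0"
      by (intro infsum_nonneg) simp
    \<comment> \<open>The square root of the frame series is a seminorm bounded by
      \<open>sqrt B\<close> times the norm, by the triangle inequality for \<open>L2_set\<close>.
      The inequality is a closed condition on \<open>d\<close>, so \<open>d = z\<close> becomes
      admissible below.\<close>
    have "sqrt A * norm d \<le> sqrt ?R + sqrt B * norm (d - z)" if "d \<in> D" for d
    proof -
      have "(\<Sum>k\<in>F. (norm (fprod d (x k)))\<^sup>2) \<le> (sqrt ?R + sqrt B * norm (d - z))\<^sup>2"
        if F: "finite F" "F \<subseteq> K" for F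
      proof -
        have "norm (fprod d (x k)) \<le> norm (fprod z (x k)) + norm (fprod (d - z) (x k))" for k
          using norm_triangle_ineq[of "fprod z (x k)" "fprod (d - z) (x k)"] by (simp add: fprod_diff)
        then have "L2_set (\<lambda>k. norm (fprod d (x k))) F
            \<le> L2_set (\<lambda>k. norm (fprod z (x k)) + norm (fprod (d - z) (x k))) F"
          by (intro L2_set_mono) auto
        also have "\<dots> \<le> L2_set (\<lambda>k. norm (fprod z (x k))) F + L2_set (\<lambda>k. norm (fprod (d - z) (x k))) F"
          by (rule L2_set_triangle_ineq)
        also have "\<dots> \<le> sqrt ?R + sqrt (B * (norm (d - z))\<^sup>2)"
          unfolding L2_set_def using F
          by (intro add_mono real_sqrt_le_mono finite_sum_le_infsum summable' partial) auto
        finally have "L2_set (\<lambda>k. norm (fprod d (x k))) F \<le> sqrt ?R + sqrt B * norm (d - z)"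
          by (simp add: real_sqrt_mult)
        then have "(L2_set (\<lambda>k. norm (fprod d (x k))) F)\<^sup>2 \<le> (sqrt ?R + sqrt B * norm (d - z))\<^sup>2"
          by (intro power_mono) auto
        then show ?thesis
          by (simp add: L2_set_def sum_nonneg)
      qed
      then have "(\<Sum>\<^sub>\<infinity>k\<in>K. (norm (fprod d (x k)))\<^sup>2) \<le> (sqrt ?R + sqrt B * norm (d - z))\<^sup>2"
        by (rule infsum_le_finite_sums[OF summable'])
      with lower[OF that] have "(sqrt A * norm d)\<^sup>2 \<le> (sqrt ?R + sqrt B * norm (d - z))\<^sup>2"
        using pos by (simp add: power_mult_distrib)
      then show ?thesis
        by (rule power2_le_imp_le) (use R pos in simp)
    qed
    moreover have "closed {d. sqrt A * norm d \<le> sqrt ?R + sqrt B * norm (d - z)}"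
      by (intro closed_Collect_le continuous_intros)
    ultimately have "sqrt A * norm z \<le> sqrt ?R + sqrt B * norm (z - z)"
      using UNIV_I[of "{d. sqrt A * norm d \<le> sqrt ?R + sqrt B * norm (d - z)}" z] by blast
    then have "(sqrt A * norm z)\<^sup>2 \<le> (sqrt ?R)\<^sup>2"
      using pos by (intro power_mono) auto
    then show ?thesis
      using pos R by (simp add: power_mult_distrib)
  qed
  then show ?thesis
    using pos summable' upper' by (simp add: b_frame_with_bounds_def)
qed

text \<open>Here \<open>g\<close> stands for the squared b-frame products of a fixed vector in the
  other factor. The double series is the frame series times \<open>infsum g L\<close>, and division
  by this constant gives the bounds; \<open>z0\<close> shows that it is positive.\<close>

lemma b_frame_of_product:
  fixes g :: "'j \<Rightarrow> real" and z0 :: 'z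
  assumes "z0 \<noteq> 0" and pos: "A > 0" "B > 0" and g: "\<And>k. g k \<ge> 0"
    and summable: "\<And>z. (\<lambda>(j, k). (norm (fprod z (x j)))\<^sup>2 * g k) summable_on (K \<times> L)"
    and lower: "\<And>z. A * (norm z)\<^sup>2 \<le> (\<Sum>\<^sub>\<infinity>(j, k)\<in>K \<times> L. (norm (fprod z (x j)))\<^sup>2 * g k)"
    and upper: "\<And>z. (\<Sum>\<^sub>\<infinity>(j, k)\<in>K \<times> L. (norm (fprod z (x j)))\<^sup>2 * g k) \<le> B * (norm z)\<^sup>2"
  shows "b_frame ipH ipZ b K x"
proof -
  let ?S = "\<lambda>z. \<Sum>\<^sub>\<infinity>(j, k)\<in>K \<times> L. (norm (fprod z (x j)))\<^sup>2 * g k"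
  have S0: "?S z0 > 0"
    using lower[of z0] \<open>z0 \<noteq> 0\<close> pos by (smt (verit) mult_pos_pos zero_less_norm_iff zero_less_power)
  \<comment> \<open>Such an index gives a row of the double series that is a positive multiple of
    \<open>g\<close>, from which summability of \<open>g\<close> follows.\<close>
  have "\<exists>j\<in>K. fprod z0 (x j) \<noteq> 0"
  proof (rule ccontr)
    assume "\<not> ?thesis"
    then have "?S z0 = 0"
      by (intro infsum_0) auto
    with S0 show False
      by simp
  qed
  then obtain j0 where j0: "j0 \<in> K" "fprod z0 (x j0) \<noteq> 0"
    by blast
  have "(\<lambda>k. (norm (fprod z0 (x j0)))\<^sup>2 * g k) summable_on L"
    using summable_on_SigmaD1[OF summable j0(1)] .
  then have gsum: "g summable_on L"
    using j0(2) by (subst (asm) summable_on_cmult_right') auto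
  have prod: "((\<lambda>j. (norm (fprod z (x j)))\<^sup>2 * infsum g L) has_sum ?S z) K" for z
    by (rule has_sum_SigmaD[OF has_sum_infsum[OF summable]])
      (auto intro!: has_sum_cmult_right has_sum_infsum gsum)
  have "infsum g L \<noteq> 0"
  proof
    assume "infsum g L = 0"
    then have "((\<lambda>j. 0) has_sum ?S z0) K"
      using prod[of z0] by simp
    then have "?S z0 = 0"
      using has_sum_0[of K "\<lambda>j. 0 :: real"] has_sum_unique by blast
    with S0 show False
      by simp
  qed
  moreover have "infsum g L \<ge> 0"
    by (intro infsum_nonneg g)
  ultimately have G: "infsum g L > 0"
    by simp
  have "((\<lambda>j. (norm (fprod z (x j)))\<^sup>2) has_sum ?S z / infsum g L) K" for z
    using prod[of z] G by (subst (asm) has_sum_cmult_left_iff) auto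
  then have "(\<lambda>j. (norm (fprod z (x j)))\<^sup>2) summable_on K"
    and "(\<Sum>\<^sub>\<infinity>j\<in>K. (norm (fprod z (x j)))\<^sup>2) = ?S z / infsum g L" for z
    using has_sum_imp_summable infsumI by blast+
  then have "b_frame_with_bounds ipH ipZ b K x (A / infsum g L) (B / infsum g L)"
    unfolding b_frame_with_bounds_def using pos G
      divide_right_mono[OF lower, of "infsum g L"] divide_right_mono[OF upper, of "infsum g L"] by simp
  then show ?thesis
    unfolding b_frame_def by blast
qed

lemma b_frame_nonzero_product:
  assumes "b_frame ipH ipZ b K x" and "z \<noteq> 0"
  shows "\<exists>k\<in>K. fprod z (x k) \<noteq> 0"
proof (rule ccontr)
  assume "\<not> ?thesis"
  then have "(\<Sum>\<^sub>\<infinity>k\<in>K. (norm (fprod z (x k)))\<^sup>2) = 0"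
    by (intro infsum_0) auto
  then obtain A where "A > 0" "A * (norm z)\<^sup>2 \<le> 0"
    using assms(1) unfolding b_frame_def b_frame_with_bounds_def by metis
  then show False
    using \<open>z \<noteq> 0\<close> by (simp add: mult_le_0_iff)
qed

text \<open>Pairing with \<open>y\<close> is continuous, so it acts term by term on the expansion,
  and only the term at \<open>j\<close> survives.\<close>

lemma has_sum_dual_coeff:
  assumes sum: "((\<lambda>k. b (h k) (x k)) has_sum z) K" and "j \<in> K"
    and y: "\<And>k. k \<in> K \<Longrightarrow> k \<noteq> j \<Longrightarrow> fprod y (x k) = 0"
  shows "ipZ z y = ipH (h j) (fprod y (x j))"
proof -
  have "((\<lambda>k. ipH (h k) (fprod y (x k))) has_sum ipZ z y) K"
    using has_sum_bounded_linear[OF Z.bounded_linear_ip_left sum, of y] by (simp add: fprod_adjoint)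
  moreover have "((\<lambda>k. ipH (h k) (fprod y (x k))) has_sum ipH (h j) (fprod y (x j))) K"
    using \<open>j \<in> K\<close> y by (intro has_sum_finite_neutralI[of "{j}"]) auto
  ultimately show ?thesis
    by (rule has_sum_unique)
qed

lemma b_basis_subfamily_zero_coeff:
  assumes basis: "b_basis b L x" and e: "inj_on e K" "e ` K \<subseteq> L"
    and sum: "((\<lambda>k. b (h k) (x (e k))) has_sum 0) K" and "j \<in> K"
  shows "h j = 0"
proof -
  have b0: "b 0 x = 0" for x
    using linear_0[OF bounded_linear.linear[OF bounded_linear_b]] .
  define h' where "h' l = (if l \<in> e ` K then h (inv_into K e l) else 0)" for l
  have h': "h' (e k) = h k" if "k \<in> K" for k
    using that e by (simp add: h'_def)
  have "(((\<lambda>l. b (h' l) (x l)) \<circ> e) has_sum 0) K"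
    using sum by (rule has_sum_cong[THEN iffD1, rotated]) (simp add: h')
  then have "((\<lambda>l. b (h' l) (x l)) has_sum 0) (e ` K)"
    using has_sum_reindex[OF e(1)] by blast
  then have "((\<lambda>l. b (h' l) (x l)) has_sum 0) L"
    by (rule has_sum_cong_neutral[THEN iffD1, rotated -1]) (use e(2) in \<open>auto simp: h'_def b0\<close>)
  then have "h' (e j) = 0"
    using basis e(2) \<open>j \<in> K\<close> by (intro b_basis_zero_coeff) auto
  with \<open>j \<in> K\<close> show ?thesis
    by (simp add: h')
qed

end

section \<open>Tensor products\<close>

locale hilbert_tensor =
  U: hilbert_space_over sU ipU + V: hilbert_space_over sV ipV
  for sU :: "'k::real_or_complex \<Rightarrow> 'u::banach \<Rightarrow> 'u" and ipU
    and sV :: "'k \<Rightarrow> 'v::banach \<Rightarrow> 'v" and ipV +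
  fixes s :: "'k \<Rightarrow> 't::banach \<Rightarrow> 't" and ip tens
  assumes tensor: "hilbert_tensor_product sU ipU sV ipV s ip tens"
begin

sublocale T: hilbert_space_over s ip
  using tensor by (simp add: hilbert_tensor_product_def)

lemma ip_tens: "ip (tens u v) (tens u' v') = ipU u u' * ipV v v'"
  using tensor by (simp add: hilbert_tensor_product_def)

lemma dense: "closure (elementary_span s tens) = UNIV"
  using tensor by (simp add: hilbert_tensor_product_def)

lemma tens_linear:
  "tens (u + u') v = tens u v + tens u' v" "tens (sU c u) v = s c (tens u v)"
  "tens u (v + v') = tens u v + tens u v'" "tens u (sV c v) = s c (tens u v)"
  using tensor by (simp_all add: hilbert_tensor_product_def bilinear_over_def Vector_Spaces.linear_iff)

text \<open>The cross-norm identity gives boundedness of \<open>tens\<close>, and later allows a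
  nonzero factor to be cancelled from a vanishing tensor.\<close>

lemma norm_tens: "norm (tens u v) = norm u * norm v"
proof -
  have "(norm (tens u v))\<^sup>2 = (norm u * norm v)\<^sup>2"
    by (simp add: T.norm_eq_ip[symmetric] ip_tens norm_mult U.norm_eq_ip V.norm_eq_ip power_mult_distrib)
  then show ?thesis
    by simp
qed

lemma bounded_bilinear_tens: "bounded_bilinear tens"
proof
  show "\<exists>K. \<forall>u v. norm (tens u v) \<le> norm u * norm v * K"
    by (rule exI[of _ 1]) (simp add: norm_tens)
qed (simp_all add: tens_linear U.scaleR_scale V.scaleR_scale T.scaleR_scale)

lemma elementary_span_cases:
  assumes "t \<in> elementary_span s tens"
  obtains n u v where "t = (\<Sum>i<(n::nat). tens (u i) (v i))"
proof -
  have "\<exists>n u v. t = (\<Sum>i<(n::nat). tens (u i) (v i))"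
    using assms unfolding elementary_span_def
  proof (induction rule: T.span_induct_alt)
    case base
    show ?case
      by (rule exI[of _ 0]) simp
  next
    case (step c x y)
    then obtain u0 v0 n u v where "x = tens u0 v0" "y = (\<Sum>i<(n::nat). tens (u i) (v i))"
      by blast
    \<comment> \<open>The scalar is absorbed into the left factor, so the sums carry no
      coefficients.\<close>
    then have "s c x + y = (\<Sum>i<Suc n. tens ((u(n := sU c u0)) i) ((v(n := v0)) i))"
      by (simp add: tens_linear)
    then show ?case
      by blast
  qed
  then show ?thesis
    using that by blast
qed

lemma norm_sum_tens: "(norm (\<Sum>i<n. tens (u i) (v i)))\<^sup>2 = gram_pairing ipU ipV n u v"
  unfolding T.norm_eq_ip[symmetric] gram_pairing_def T.ip_sum_left
  unfolding T.ip_sum_right ip_tens ..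

text \<open>The set where \<open>f\<close> and \<open>g\<close> agree is closed and contains all
  finite sums of elementary tensors, which are dense. Real linearity suffices since these sums have
  no scalar coefficients.\<close>

lemma bounded_linear_tens_ext:
  fixes f g :: "'t \<Rightarrow> 'w::real_normed_vector"
  assumes "bounded_linear f" "bounded_linear g" and eq: "\<And>u v. f (tens u v) = g (tens u v)"
  shows "f t = g t"
proof -
  have "elementary_span s tens \<subseteq> {t. f t = g t}"
  proof
    fix t assume "t \<in> elementary_span s tens"
    then obtain n u v where "t = (\<Sum>i<(n::nat). tens (u i) (v i))"
      by (rule elementary_span_cases)
    then show "t \<in> {t. f t = g t}"
      using assms by (simp add: bounded_linear.linear linear_sum)
  qed
  moreover have "closed {t. f t = g t}"
    using assms by (intro closed_Collect_eq linear_continuous_on)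
  ultimately show ?thesis
    using closure_minimal dense by blast
qed

end

section \<open>b-frames and b-Riesz bases of elementary tensors\<close>

locale b_tensor =
  S1: b_system sH1 ipH1 sZ1 ipZ1 b1 + S2: b_system sH2 ipH2 sZ2 ipZ2 b2 +
  S: b_system sH ipH sZ ipZ b +
  HT: hilbert_tensor sH1 ipH1 sH2 ipH2 sH ipH tensH +
  ZT: hilbert_tensor sZ1 ipZ1 sZ2 ipZ2 sZ ipZ tensZ
  for sH1 :: "'k::real_or_complex \<Rightarrow> 'h1::banach \<Rightarrow> 'h1" and ipH1
    and sZ1 :: "'k \<Rightarrow> 'z1::banach \<Rightarrow> 'z1" and ipZ1 and b1 :: "'h1 \<Rightarrow> 'b1 \<Rightarrow> 'z1"
    and sH2 :: "'k \<Rightarrow> 'h2::banach \<Rightarrow> 'h2" and ipH2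
    and sZ2 :: "'k \<Rightarrow> 'z2::banach \<Rightarrow> 'z2" and ipZ2 and b2 :: "'h2 \<Rightarrow> 'b2 \<Rightarrow> 'z2"
    and sH :: "'k \<Rightarrow> 'h::banach \<Rightarrow> 'h" and ipH
    and sZ :: "'k \<Rightarrow> 'z::banach \<Rightarrow> 'z" and ipZ and b :: "'h \<Rightarrow> 'b \<Rightarrow> 'z"
    and tensH and tensZ +
  fixes tensB :: "'b1 \<Rightarrow> 'b2 \<Rightarrow> 'b"
  assumes b_tens: "b (tensH h1 h2) (tensB x1 x2) = tensZ (b1 h1 x1) (b2 h2 x2)"
begin

abbreviation tensor_family :: "('i \<Rightarrow> 'b1) \<Rightarrow> ('j \<Rightarrow> 'b2) \<Rightarrow> 'i \<times> 'j \<Rightarrow> 'b" where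
  "tensor_family x1 x2 \<equiv> \<lambda>(j, k). tensB (x1 j) (x2 k)"

text \<open>The adjoint of a tensor product of operators is the tensor product of the adjoints: the
  defining identity is checked for elementary \<open>h\<close> and extended by density.\<close>

lemma fprod_tens:
  "S.fprod (tensZ z1 z2) (tensB x1 x2) = tensH (S1.fprod z1 x1) (S2.fprod z2 x2)"
proof (rule S.fprod_unique)
  fix h
  show "ipZ (b h (tensB x1 x2)) (tensZ z1 z2) = ipH h (tensH (S1.fprod z1 x1) (S2.fprod z2 x2))"
  proof (rule HT.bounded_linear_tens_ext[where t=h and f="\<lambda>h. ipZ (b h (tensB x1 x2)) (tensZ z1 z2)"
        and g="\<lambda>h. ipH h (tensH (S1.fprod z1 x1) (S2.fprod z2 x2))"])
    show "bounded_linear (\<lambda>h. ipZ (b h (tensB x1 x2)) (tensZ z1 z2))"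
      using bounded_linear_compose[OF S.Z.bounded_linear_ip_left S.bounded_linear_b] .
    show "bounded_linear (\<lambda>h. ipH h (tensH (S1.fprod z1 x1) (S2.fprod z2 x2)))"
      by (rule S.H.bounded_linear_ip_left)
  qed (simp add: b_tens ZT.ip_tens HT.ip_tens S1.fprod_adjoint S2.fprod_adjoint)
qed

lemma norm_fprod_sum_tens:
  "(norm (S.fprod (\<Sum>i<n. tensZ (u i) (v i)) (tensB x1 x2)))\<^sup>2
    = gram_pairing ipH1 ipH2 n (\<lambda>i. S1.fprod (u i) x1) (\<lambda>i. S2.fprod (v i) x2)"
  by (simp add: S.fprod_sum fprod_tens HT.norm_sum_tens)

text \<open>For a finite sum of elementary tensors the pairing passes from \<open>Z1, Z2\<close> to
  \<open>H1, H2\<close> through the mixed pair \<open>H1, Z2\<close>, with one frame inequality per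
  stage. Density covers the remaining vectors.\<close>

theorem tensor_b_frame_with_bounds:
  assumes frame1: "b_frame_with_bounds ipH1 ipZ1 b1 K x1 A1 B1"
    and frame2: "b_frame_with_bounds ipH2 ipZ2 b2 L x2 A2 B2"
  shows "b_frame_with_bounds ipH ipZ b (K \<times> L) (tensor_family x1 x2) (A1 * A2) (B1 * B2)"
proof -
  have pos: "A1 > 0" "B1 > 0" "A2 > 0" "B2 > 0"
    using frame1 frame2 by (auto simp: b_frame_with_bounds_def)
  have bounds: "(\<lambda>k. (norm (S.fprod t (tensor_family x1 x2 k)))\<^sup>2) summable_on (K \<times> L) \<and>
      A1 * A2 * (norm t)\<^sup>2 \<le> (\<Sum>\<^sub>\<infinity>k\<in>K \<times> L. (norm (S.fprod t (tensor_family x1 x2 k)))\<^sup>2) \<and>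
      (\<Sum>\<^sub>\<infinity>k\<in>K \<times> L. (norm (S.fprod t (tensor_family x1 x2 k)))\<^sup>2) \<le> B1 * B2 * (norm t)\<^sup>2"
    if elem: "t \<in> elementary_span sZ tensZ" for t
  proof -
    obtain n u v where t: "t = (\<Sum>i<(n::nat). tensZ (u i) (v i))"
      using elem by (rule ZT.elementary_span_cases)
    let ?f = "\<lambda>j k. gram_pairing ipH1 ipH2 n (\<lambda>i. S1.fprod (u i) (x1 j)) (\<lambda>i. S2.fprod (v i) (x2 k))"
    let ?g = "\<lambda>j. gram_pairing ipH1 ipZ2 n (\<lambda>i. S1.fprod (u i) (x1 j)) v"
    \<comment> \<open>\<open>gram_pairing_frame\<close> acts on the second family of the pairing, so
      the families are swapped before the frame inequality of \<open>x1\<close> is used.\<close>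
    have g: "?g j = gram_pairing ipZ2 ipH1 n v (\<lambda>i. S1.fprod (u i) (x1 j))" for j
      by (rule gram_pairing_commute)
    note frame1' = S1.gram_pairing_frame[OF S2.Z.hilbert_space_over_axioms frame1, of n v u, folded g]
    note frame2' = S2.gram_pairing_frame[OF S1.H.hilbert_space_over_axioms frame2]
    have "(\<lambda>(j, k). ?f j k) summable_on (K \<times> L) \<and>
        A1 * A2 * gram_pairing ipZ2 ipZ1 n v u \<le> (\<Sum>\<^sub>\<infinity>(j, k)\<in>K \<times> L. ?f j k) \<and>
        (\<Sum>\<^sub>\<infinity>(j, k)\<in>K \<times> L. ?f j k) \<le> B1 * B2 * gram_pairing ipZ2 ipZ1 n v u"
    proof (rule iterated_infsum_bounds[where g="?g"])
      show "?f j k \<ge> 0" for j k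
        by (simp add: gram_pairing_def)
    qed (rule frame1' frame2' pos)+
    moreover have "gram_pairing ipZ2 ipZ1 n v u = (norm t)\<^sup>2"
      by (simp add: t ZT.norm_sum_tens gram_pairing_commute[of ipZ1])
    ultimately show ?thesis
      by (simp add: t norm_fprod_sum_tens case_prod_unfold)
  qed
  show ?thesis
    by (rule S.b_frame_with_bounds_dense[OF ZT.dense]) (use pos bounds in auto)
qed

lemma tensor_b_frame:
  assumes "b_frame ipH1 ipZ1 b1 K x1" "b_frame ipH2 ipZ2 b2 L x2"
  shows "b_frame ipH ipZ b (K \<times> L) (tensor_family x1 x2)"
  using assms tensor_b_frame_with_bounds unfolding b_frame_def by blast

text \<open>On \<open>tensZ z1 z2\<close> the b-frame series is a product series; fixing one factor
  at a nonzero vector leaves a frame inequality in the other. If one space were zero, the tensor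
  product would be zero and every family a b-frame for it.\<close>

lemma b_frame_factors:
  assumes frame: "b_frame ipH ipZ b (K \<times> L) (tensor_family x1 x2)"
    and nonzero: "(w1 :: 'z1) \<noteq> 0" "(w2 :: 'z2) \<noteq> 0"
  shows "b_frame ipH1 ipZ1 b1 K x1" "b_frame ipH2 ipZ2 b2 L x2"
proof -
  obtain A B where AB: "b_frame_with_bounds ipH ipZ b (K \<times> L) (tensor_family x1 x2) A B"
    using frame unfolding b_frame_def by blast
  let ?f = "\<lambda>z1 j. (norm (S1.fprod z1 (x1 j)))\<^sup>2" and ?g = "\<lambda>z2 k. (norm (S2.fprod z2 (x2 k)))\<^sup>2"
  have pos: "A > 0" "B > 0"
    using AB by (auto simp: b_frame_with_bounds_def)
  have norm_eq: "(norm (S.fprod (tensZ z1 z2) (tensor_family x1 x2 p)))\<^sup>2 = (case p of (j, k) \<Rightarrow> ?f z1 j * ?g z2 k)"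
    for z1 z2 p
    by (simp add: fprod_tens HT.norm_tens power_mult_distrib split: prod.split)
  have bounds: "(\<lambda>(j, k). ?f z1 j * ?g z2 k) summable_on (K \<times> L)"
    "A * (norm z1 * norm z2)\<^sup>2 \<le> (\<Sum>\<^sub>\<infinity>(j, k)\<in>K \<times> L. ?f z1 j * ?g z2 k)"
    "(\<Sum>\<^sub>\<infinity>(j, k)\<in>K \<times> L. ?f z1 j * ?g z2 k) \<le> B * (norm z1 * norm z2)\<^sup>2" for z1 z2
    using AB unfolding b_frame_with_bounds_def norm_eq[symmetric] ZT.norm_tens[symmetric] by blast+
  show "b_frame ipH1 ipZ1 b1 K x1"
    by (rule S1.b_frame_of_product[where ?z0.0=w1 and g="?g w2" and L=L
          and A="A * (norm w2)\<^sup>2" and B="B * (norm w2)\<^sup>2"])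
      (use bounds[of _ w2] nonzero pos in \<open>simp_all add: power_mult_distrib mult_ac\<close>)
  \<comment> \<open>\<open>b_frame_of_product\<close> puts the index of the system under study
    first, so the double series is transposed for the second factor.\<close>
  have swap: "(\<lambda>(k, j). ?g z2 k * ?f z1 j) summable_on (L \<times> K)"
    "(\<Sum>\<^sub>\<infinity>(k, j)\<in>L \<times> K. ?g z2 k * ?f z1 j) = (\<Sum>\<^sub>\<infinity>(j, k)\<in>K \<times> L. ?f z1 j * ?g z2 k)" for z1 z2
  proof -
    have "((\<lambda>(k, j). ?g z2 k * ?f z1 j) has_sum (\<Sum>\<^sub>\<infinity>(j, k)\<in>K \<times> L. ?f z1 j * ?g z2 k)) (L \<times> K)"
      using has_sum_infsum[OF bounds(1), of z1 z2] by (subst has_sum_swap) (simp add: mult.commute)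
    then show "(\<lambda>(k, j). ?g z2 k * ?f z1 j) summable_on (L \<times> K)"
      "(\<Sum>\<^sub>\<infinity>(k, j)\<in>L \<times> K. ?g z2 k * ?f z1 j) = (\<Sum>\<^sub>\<infinity>(j, k)\<in>K \<times> L. ?f z1 j * ?g z2 k)"
      by (rule has_sum_imp_summable, rule infsumI)
  qed
  show "b_frame ipH2 ipZ2 b2 L x2"
  proof (rule S2.b_frame_of_product[where ?z0.0=w2 and g="?f w1" and L=K
          and A="A * (norm w1)\<^sup>2" and B="B * (norm w1)\<^sup>2"])
    show "(\<lambda>(k, j). ?g z2 k * ?f w1 j) summable_on (L \<times> K)" for z2
      by (rule swap)
  qed (use bounds[of w1] nonzero pos in \<open>simp_all only: swap, simp_all add: power_mult_distrib mult_ac\<close>)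
qed

text \<open>Testing a vanishing expansion against \<open>y1 \<otimes> y2\<close>, with \<open>yi\<close> dual to a single index,
  isolates one coefficient.\<close>

lemma tensor_b_riesz_basis:
  assumes riesz1: "b_riesz_basis ipH1 ipZ1 b1 K x1" and riesz2: "b_riesz_basis ipH2 ipZ2 b2 L x2"
  shows "b_riesz_basis ipH ipZ b (K \<times> L) (tensor_family x1 x2)"
proof -
  have frame: "b_frame ipH ipZ b (K \<times> L) (tensor_family x1 x2)"
    using assms by (intro tensor_b_frame) (simp_all add: b_riesz_basis_def)
  then obtain A B where AB: "b_frame_with_bounds ipH ipZ b (K \<times> L) (tensor_family x1 x2) A B"
    unfolding b_frame_def by blast
  have "b_basis b (K \<times> L) (tensor_family x1 x2)"
  proof (rule S.b_basis_frameI[OF AB])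
    fix h p
    assume sum: "((\<lambda>k. b (h k) (tensor_family x1 x2 k)) has_sum 0) (K \<times> L)" and "p \<in> K \<times> L"
    then obtain j k where p: "p = (j, k)" "j \<in> K" "k \<in> L"
      by blast
    have orth: "ipH (h p) (tensH g1 g2) = 0" for g1 g2
    proof -
      obtain y1 where y1: "\<forall>i\<in>K. S1.fprod y1 (x1 i) = (if i = j then g1 else 0)"
        using S1.b_riesz_basis_dual[OF riesz1 p(2)] by blast
      obtain y2 where y2: "\<forall>i\<in>L. S2.fprod y2 (x2 i) = (if i = k then g2 else 0)"
        using S2.b_riesz_basis_dual[OF riesz2 p(3)] by blast
      \<comment> \<open>For \<open>q\<close> different from \<open>p\<close> at least one factor is
        zero, and \<open>norm_tens\<close> makes the tensor zero.\<close>
      have fprod: "S.fprod (tensZ y1 y2) (tensor_family x1 x2 q) = (if q = p then tensH g1 g2 else 0)"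
        if "q \<in> K \<times> L" for q
        using that y1 y2 HT.norm_tens[of 0] HT.norm_tens[of _ 0] by (auto simp: fprod_tens p(1) split: if_split_asm)
      have "ipZ 0 (tensZ y1 y2) = ipH (h p) (S.fprod (tensZ y1 y2) (tensor_family x1 x2 p))"
        by (rule S.has_sum_dual_coeff[OF sum \<open>p \<in> K \<times> L\<close>]) (simp only: fprod if_False)
      then show ?thesis
        using fprod[OF \<open>p \<in> K \<times> L\<close>] by simp
    qed
    \<comment> \<open>Orthogonality to elementary tensors extends to all vectors by density;
      \<open>h p\<close> moves to the second argument because the extension lemma needs linearity in
      \<open>g\<close>.\<close>
    have "ipH g (h p) = 0" for g
    proof (rule HT.bounded_linear_tens_ext[where t=g and f="\<lambda>g. ipH g (h p)" and g="\<lambda>_. 0"])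
      show "ipH (tensH g1 g2) (h p) = 0" for g1 g2
        using orth[of g1 g2] S.H.ip_commute[of "tensH g1 g2" "h p"] by simp
    qed (rule S.H.bounded_linear_ip_left bounded_linear_zero)+
    then show "h p = 0"
      by (intro S.H.ip_ext) simp
  qed
  with frame show ?thesis
    by (simp add: b_riesz_basis_def)
qed

text \<open>An expansion of zero in one factor, tensored with a fixed vector of the other, is an
  expansion of zero along a slice of the product family. Uniqueness kills the tensor coefficients,
  and the fixed nonzero coefficient is cancelled. The vectors \<open>w1\<close> and
  \<open>w2\<close> supply the slice index and that coefficient.\<close>

lemma b_riesz_basis_factors:
  assumes riesz: "b_riesz_basis ipH ipZ b (K \<times> L) (tensor_family x1 x2)"
    and nonzero: "(w1 :: 'z1) \<noteq> 0" "(w2 :: 'z2) \<noteq> 0"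
  shows "b_riesz_basis ipH1 ipZ1 b1 K x1" "b_riesz_basis ipH2 ipZ2 b2 L x2"
proof -
  have basis: "b_basis b (K \<times> L) (tensor_family x1 x2)"
    and frame: "b_frame ipH ipZ b (K \<times> L) (tensor_family x1 x2)"
    using riesz by (auto simp: b_riesz_basis_def)
  note frames = b_frame_factors[OF frame nonzero]
  note tens0 = bounded_bilinear.zero_left[OF ZT.bounded_bilinear_tens]
    bounded_bilinear.zero_right[OF ZT.bounded_bilinear_tens]
  obtain A1 B1 where AB1: "b_frame_with_bounds ipH1 ipZ1 b1 K x1 A1 B1"
    using frames(1) unfolding b_frame_def by blast
  obtain A2 B2 where AB2: "b_frame_with_bounds ipH2 ipZ2 b2 L x2 A2 B2"
    using frames(2) unfolding b_frame_def by blast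
  obtain j0 where j0: "j0 \<in> K" "S1.fprod w1 (x1 j0) \<noteq> 0"
    using S1.b_frame_nonzero_product[OF frames(1) nonzero(1)] by blast
  obtain k0 where k0: "k0 \<in> L" "S2.fprod w2 (x2 k0) \<noteq> 0"
    using S2.b_frame_nonzero_product[OF frames(2) nonzero(2)] by blast
  let ?g1 = "S1.fprod w1 (x1 j0)" and ?g2 = "S2.fprod w2 (x2 k0)"
  have "b_basis b1 K x1"
  proof (rule S1.b_basis_frameI[OF AB1])
    fix h j assume sum: "((\<lambda>k. b1 (h k) (x1 k)) has_sum 0) K" and "j \<in> K"
    have "((\<lambda>k. tensZ (b1 (h k) (x1 k)) (b2 ?g2 (x2 k0))) has_sum 0) K"
      using has_sum_bounded_linear[OF bounded_bilinear.bounded_linear_left[OF ZT.bounded_bilinear_tens] sum]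
      by (simp add: tens0)
    then have "((\<lambda>k. b (tensH (h k) ?g2) (tensor_family x1 x2 (k, k0))) has_sum 0) K"
      by (simp add: b_tens)
    then have "tensH (h j) ?g2 = 0"
      by (rule S.b_basis_subfamily_zero_coeff[OF basis, rotated 2])
        (use \<open>j \<in> K\<close> k0 in \<open>auto intro: inj_onI\<close>)
    then show "h j = 0"
      using HT.norm_tens[of "h j" ?g2] k0(2) by simp
  qed
  with frames(1) show "b_riesz_basis ipH1 ipZ1 b1 K x1"
    by (simp add: b_riesz_basis_def)
  have "b_basis b2 L x2"
  proof (rule S2.b_basis_frameI[OF AB2])
    fix h j assume sum: "((\<lambda>k. b2 (h k) (x2 k)) has_sum 0) L" and "j \<in> L"
    have "((\<lambda>k. tensZ (b1 ?g1 (x1 j0)) (b2 (h k) (x2 k))) has_sum 0) L"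
      using has_sum_bounded_linear[OF bounded_bilinear.bounded_linear_right[OF ZT.bounded_bilinear_tens] sum]
      by (simp add: tens0)
    then have "((\<lambda>k. b (tensH ?g1 (h k)) (tensor_family x1 x2 (j0, k))) has_sum 0) L"
      by (simp add: b_tens)
    then have "tensH ?g1 (h j) = 0"
      by (rule S.b_basis_subfamily_zero_coeff[OF basis, rotated 2])
        (use \<open>j \<in> L\<close> j0 in \<open>auto intro: inj_onI\<close>)
    then show "h j = 0"
      using HT.norm_tens[of ?g1 "h j"] j0(2) by simp
  qed
  with frames(2) show "b_riesz_basis ipH2 ipZ2 b2 L x2"
    by (simp add: b_riesz_basis_def)
qed

end

section \<open>From the stated hypotheses to the abstract setting\<close>

lemma b_systemI:
  assumes "hilbert_space_over sH ipH" "hilbert_space_over sZ ipZ" "bounded_bilinear_over sH sB sZ b"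
  shows "b_system sH ipH sZ ipZ b"
proof -
  interpret H: hilbert_space_over sH ipH by fact
  interpret Z: hilbert_space_over sZ ipZ by fact
  obtain M where M: "\<And>h x. norm (b h x) \<le> M * norm h * norm x"
    using assms(3) unfolding bounded_bilinear_over_def by blast
  show ?thesis
  proof
    show "\<exists>M. \<forall>h. norm (b h x) \<le> norm h * M" for x
      using M[of _ x] by (intro exI[of _ "M * norm x"]) (simp add: mult_ac)
  qed (use assms(3) in \<open>simp_all add: bounded_bilinear_over_def bilinear_over_def Vector_Spaces.linear_iff\<close>)
qed

text \<open>The equivalences are stated for nonzero \<open>Z1\<close> and \<open>Z2\<close>: when
  one of them is zero the tensor product is zero, and a b-frame for it says nothing about the other
  factor. The implications from the factors to the product, and the bounds, are stated for all
  spaces.\<close>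

theorem theorem4p2:
  fixes sH1 :: "'k::real_or_complex \<Rightarrow> 'h1::banach \<Rightarrow> 'h1" and ipH1 :: "'h1 \<Rightarrow> 'h1 \<Rightarrow> 'k"
    and sH2 :: "'k \<Rightarrow> 'h2::banach \<Rightarrow> 'h2" and ipH2 :: "'h2 \<Rightarrow> 'h2 \<Rightarrow> 'k"
    and sZ1 :: "'k \<Rightarrow> 'z1::banach \<Rightarrow> 'z1" and ipZ1 :: "'z1 \<Rightarrow> 'z1 \<Rightarrow> 'k"
    and sZ2 :: "'k \<Rightarrow> 'z2::banach \<Rightarrow> 'z2" and ipZ2 :: "'z2 \<Rightarrow> 'z2 \<Rightarrow> 'k"
    and sB1 :: "'k \<Rightarrow> 'b1::banach \<Rightarrow> 'b1" and sB2 :: "'k \<Rightarrow> 'b2::banach \<Rightarrow> 'b2"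
    and sH :: "'k \<Rightarrow> 'h::banach \<Rightarrow> 'h" and ipH :: "'h \<Rightarrow> 'h \<Rightarrow> 'k" and tensH :: "'h1 \<Rightarrow> 'h2 \<Rightarrow> 'h"
    and sZ :: "'k \<Rightarrow> 'z::banach \<Rightarrow> 'z" and ipZ :: "'z \<Rightarrow> 'z \<Rightarrow> 'k" and tensZ :: "'z1 \<Rightarrow> 'z2 \<Rightarrow> 'z"
    and sB :: "'k \<Rightarrow> 'b::banach \<Rightarrow> 'b" and tensB :: "'b1 \<Rightarrow> 'b2 \<Rightarrow> 'b"
    and b1 :: "'h1 \<Rightarrow> 'b1 \<Rightarrow> 'z1" and b2 :: "'h2 \<Rightarrow> 'b2 \<Rightarrow> 'z2" and b :: "'h \<Rightarrow> 'b \<Rightarrow> 'z"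
    and K :: "'i set" and x1 :: "'i \<Rightarrow> 'b1" and x2 :: "'i \<Rightarrow> 'b2"
  assumes "hilbert_space_over sH1 ipH1" and "separable_space (euclidean :: 'h1 topology)"
    and "hilbert_space_over sH2 ipH2" and "separable_space (euclidean :: 'h2 topology)"
    and "hilbert_space_over sZ1 ipZ1" and "separable_space (euclidean :: 'z1 topology)"
    and "hilbert_space_over sZ2 ipZ2" and "separable_space (euclidean :: 'z2 topology)"
    and "banach_space_over sB1" and "banach_space_over sB2"
    and "bounded_bilinear_over sH1 sB1 sZ1 b1" and "bounded_bilinear_over sH2 sB2 sZ2 b2"
    and "hilbert_tensor_product sH1 ipH1 sH2 ipH2 sH ipH tensH"
    and "hilbert_tensor_product sZ1 ipZ1 sZ2 ipZ2 sZ ipZ tensZ"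
    and "projective_tensor_product sB1 sB2 sB tensB"
    and "bilinear_tensor_product sH tensH sB tensB sZ tensZ b1 b2 b"
    and "countable K"
  shows "((\<exists>z::'z1. z \<noteq> 0) \<and> (\<exists>z::'z2. z \<noteq> 0) \<longrightarrow>
            (b_frame ipH ipZ b (K \<times> K) (\<lambda>(j, k). tensB (x1 j) (x2 k)) \<longleftrightarrow>
               b_frame ipH1 ipZ1 b1 K x1 \<and> b_frame ipH2 ipZ2 b2 K x2) \<and>
            (b_riesz_basis ipH ipZ b (K \<times> K) (\<lambda>(j, k). tensB (x1 j) (x2 k)) \<longleftrightarrow>
               b_riesz_basis ipH1 ipZ1 b1 K x1 \<and> b_riesz_basis ipH2 ipZ2 b2 K x2))
       \<and> (b_frame ipH1 ipZ1 b1 K x1 \<and> b_frame ipH2 ipZ2 b2 K x2 \<longrightarrow>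
            b_frame ipH ipZ b (K \<times> K) (\<lambda>(j, k). tensB (x1 j) (x2 k)))
       \<and> (b_riesz_basis ipH1 ipZ1 b1 K x1 \<and> b_riesz_basis ipH2 ipZ2 b2 K x2 \<longrightarrow>
            b_riesz_basis ipH ipZ b (K \<times> K) (\<lambda>(j, k). tensB (x1 j) (x2 k)))
       \<and> (\<forall>A1 B1 A2 B2.
            b_frame_with_bounds ipH1 ipZ1 b1 K x1 A1 B1 \<and>
            b_frame_with_bounds ipH2 ipZ2 b2 K x2 A2 B2 \<longrightarrow>
            b_frame_with_bounds ipH ipZ b (K \<times> K) (\<lambda>(j, k). tensB (x1 j) (x2 k)) (A1 * A2) (B1 * B2))"
proof -
  have HT: "hilbert_space_over sH ipH" and ZT: "hilbert_space_over sZ ipZ"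
    using assms(13,14) by (auto simp: hilbert_tensor_product_def)
  interpret b_tensor sH1 ipH1 sZ1 ipZ1 b1 sH2 ipH2 sZ2 ipZ2 b2 sH ipH sZ ipZ b tensH tensZ tensB
  proof (intro b_tensor.intro b_tensor_axioms.intro)
    show "b_system sH1 ipH1 sZ1 ipZ1 b1" "b_system sH2 ipH2 sZ2 ipZ2 b2"
      using assms b_systemI by blast+
    show "b_system sH ipH sZ ipZ b"
      using assms(16) HT ZT b_systemI unfolding bilinear_tensor_product_def by blast
    show "hilbert_tensor sH1 ipH1 sH2 ipH2 sH ipH tensH" "hilbert_tensor sZ1 ipZ1 sZ2 ipZ2 sZ ipZ tensZ"
      using assms by (auto intro!: hilbert_tensor.intro hilbert_tensor_axioms.intro)
    show "b (tensH h1 h2) (tensB x1 x2) = tensZ (b1 h1 x1) (b2 h2 x2)" for h1 h2 x1 x2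
      using assms(16) unfolding bilinear_tensor_product_def by blast
  qed
  show ?thesis
    by (intro conjI impI allI iffI; (elim conjE exE)?)
      (rule tensor_b_frame tensor_b_riesz_basis b_frame_factors b_riesz_basis_factors
        tensor_b_frame_with_bounds; assumption)+
qed

end
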